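(* Let $\sigma\in\{\sigma_1,\sigma_2,\sigma_4\}$ with the signs $\epsilon_i$, the one-sided sequence $\omega_\sigma=s_0s_1\cdots s_k\cdots$ and the Rauzy fractals $X_\sigma$, $X_\sigma^{(i^{\epsilon_i})}$, $X_\sigma'^{(i^{\epsilon_i})}$ as defined in the context. For $i\in\{1,2\}$ put $$Y_\sigma:=\{-\pi_\sigma f(s_0s_1\cdots s_k)\mid k\ge0\},$$ $$Y_\sigma^{(i^{\epsilon_i})}:=\{-\pi_\sigma f(s_0s_1\cdots s_{k-1})\mid k\ge0,\ s_k=i^{\epsilon_i}\},$$ $$Y_\sigma'^{(i^{\epsilon_i})}:=\{-\pi_\sigma f(s_0s_1\cdots s_k)\mid k\ge0,\ s_k=i^{\epsilon_i}\}.$$ Then, denoting closure by an overline, $$X_\sigma=\overline{Y_\sigma},\qquad X_\sigma^{(i^{\epsilon_i})}=\overline{Y_\sigma^{(i^{\epsilon_i})}},\qquad X_\sigma'^{(i^{\epsilon_i})}=\overline{Y_\sigma'^{(i^{\epsilon_i})}},\qquad i\in\{1,2\}.$$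
   Context: Let $F_2$ be the free group on the letters $1,2$, and let $f:F_2\to\mathbb Z^2$ be the homomorphism with $f(i^{\pm1})=\pm e_i$ ($e_1,e_2$ the standard basis; $f$ of the empty word is $0$). For an endomorphism $\sigma$ of $F_2$, $A_\sigma$ is the $2\times2$ matrix with columns $f(\sigma(1)),f(\sigma(2))$. The automorphisms ($2^{k}$ with $k<0$ means $(2^{-1})^{|k|}$; $a$ is an integer): - $t=1$, $a\ge3$: $\sigma_1:1\mapsto2,\ 2\mapsto2^{a-2}1^{-1}22$; $\tau_1:1\mapsto2^{a-3}12,\ 2\mapsto2^{a-2}12$; $\delta_1:1\mapsto21^{-1},\ 2\mapsto2$; $\delta_1^{-1}:1\mapsto1^{-1}2,\ 2\mapsto2$. - $t=2$, $a\le-3$: $\sigma_2:1\mapsto2,\ 2\mapsto1^{-1}2^{a}$; $\tau_2:1\mapsto1^{-1}2^{a+2},\ 2\mapsto1^{-1}2^{a+1}$; $\delta_2:1\mapsto2^{-1}1,\ 2\mapsto2$; $\delta_2^{-1}:1\mapsto21,\ 2\mapsto2$. - $t=4$, $a\le-1$: $\sigma_4:1\mapsto2,\ 2\mapsto12^{a}$; $\tau_4:1\mapsto2^{-1},\ 2\mapsto1^{-1}2^{a}$; $\delta_4=\delta_4^{-1}:1\mapsto1^{-1},\ 2\mapsto2$. In each case $\sigma_t=\delta_t^{-1}\circ\tau_t\circ\delta_t$. The matrix $A_{\sigma_t}$ has eigenvalues $\lambda_t,\lambda_t'$ with $|\lambda_t|>1>|\lambda_t'|$. Signs: $\epsilon_1=-1$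 for $t=1,4$, $\epsilon_1=1$ for $t=2$, and $\epsilon_2=1$ always. Sequences: $\omega_{\sigma_1}=\lim_n\sigma_1^n(2)$ and $\omega_{\sigma_t}=\lim_n\sigma_t^{2n}(2)$ for $t=2,4$ (limits of reduced words in the product topology). Equivalently $\omega_{\sigma_t}=\delta_t^{-1}(\omega_{\tau_t})$, where $\omega_{\tau_1}=\lim_n\tau_1^n(2)$ and $\omega_{\tau_t}=\lim_n\tau_t^{2n}(2)$ for $t=2,4$ are sequences over $\{1,2\}$. Each $\omega_{\sigma_t}=s_0s_1s_2\cdots$ is a one-sided infinite sequence over the two letters $1^{\epsilon_1},2^{\epsilon_2}$. $\mathcal G^*$ is the free $\mathbb Z$-module with basis the symbols $(x,i^* )$, $x\in\mathbb Z^2$, $i\in\{1,2\}$. The symbol $(x,1^* )$ is identified with the unit segment $\{x+se_2:0\le s\le1\}$ and $(x,2^* )$ with $\{x+se_1:0\le s\le1\}$; an element of $\mathcal G^*$ is identified, as a subset of $\mathbb R^2$, with the union of the segments occurring with nonzero coefficient. For an endomorphism $\sigma$ of $F_2$ with $\det A_\sigma=\pm1$ and $\sigma(j)=w^{(j)}_1\cdots w^{(j)}_{l^{(j)}}$ (reduced word), put $S^{(j)}_k=w^{(j)}_{k+1}\cdots w^{(j)}_{l^{(j)}}$. The tiling substitution $\sigma^*:\mathcal G^*\to\mathcal G^*$ is the $\mathbb Z$-linear map $$\sigma^*(x,i^* )=\sum_{j\in\{1,2\}}\Big\{\sum_{k:\,w^{(j)}_k=i}\big(A_\sigma^{-1}(x+f(S^{(j)}_k)),j^*\big)-\sum_{k:\,w^{(j)}_k=i^{-1}}\big(A_\sigma^{-1}(x+f(w^{(j)}_kS^{(j)}_k)),j^*\big)\Big\},$$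 and $\sigma^{*\,n}$ is its $n$-th iterate. $P_{\sigma_t}\subset\mathbb R^2$ is the eigenline of $A_{\sigma_t}$ for $\lambda_t'$, and $\pi_{\sigma_t}:\mathbb R^2\to P_{\sigma_t}$ is the projection along the eigenline of $A_{\sigma_t}$ for $\lambda_t$. Rauzy fractals (limits of compact sets in the Hausdorff metric; these limits exist), for $\sigma=\sigma_t$: $X_\sigma=\lim_n A_\sigma^n\pi_\sigma\sigma^{*\,n}(\overline{\mathcal U})$, where $\overline{\mathcal U}=(e_1,1^* )+(e_2,2^* )$ if $t=2$ and $\overline{\mathcal U}=(0,1^* )+(e_2,2^* )$ if $t=1,4$. For $t=2$: $X_{\sigma}^{(i)}=\lim_n A_{\sigma}^n\pi_{\sigma}\sigma^{*\,n}(e_i,i^* )$, $X_{\sigma}'^{(i)}=\lim_n A_{\sigma}^n\pi_{\sigma}\sigma^{*\,n}(0,i^* )$. For $t=1,4$: $X_{\sigma}^{(1^{-1})}=\lim_n A_{\sigma}^n\pi_{\sigma}\sigma^{*\,n}(0,1^* )$, $X_{\sigma}^{(2)}=\lim_n A_{\sigma}^n\pi_{\sigma}\sigma^{*\,n}(e_2,2^* )$, $X_{\sigma}'^{(1^{-1})}=\lim_n A_{\sigma}^n\pi_{\sigma}\sigma^{*\,n}(e_1,1^* )$, $X_{\sigma}'^{(2)}=\lim_n A_{\sigma}^n\pi_{\sigma}\sigma^{*\,n}(0,2^* )$. *)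

theory Defs
  imports "HOL-Analysis.Analysis" "HOL-Library.Poly_Mapping"
begin

section \<open>The free group on two letters\<close>

text \<open>
  The two letters are the elements 1 and 2 of the two-element type \<^typ>\<open>2\<close>, which also indexes the
  coordinates of the plane. Elements of the free group are reduced words in the letters and their
  inverses. An endomorphism is given by the reduced words that are the images of the letters.
\<close>

datatype letter = Gen "2" | Inv "2"

type_synonym word = "letter list"
type_synonym endo = "2 \<Rightarrow> word"

fun inv_letter :: "letter \<Rightarrow> letter" where
  "inv_letter (Gen i) = Inv i"
| "inv_letter (Inv i) = Gen i"

definition inv_word :: "word \<Rightarrow> word" where
  "inv_word w = rev (map inv_letter w)"

definition reduced :: "word \<Rightarrow> bool" where
  "reduced w \<longleftrightarrow> successively (\<lambda>l m. m \<noteq> inv_letter l) w"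

fun push :: "letter \<Rightarrow> word \<Rightarrow> word" where
  "push l [] = [l]"
| "push l (m # w) = (if m = inv_letter l then w else l # m # w)"

definition reduce :: "word \<Rightarrow> word" where
  "reduce w = foldr push w []"

definition gen_power :: "2 \<Rightarrow> int \<Rightarrow> word" where
  "gen_power i k = (if 0 \<le> k then replicate (nat k) (Gen i) else replicate (nat (- k)) (Inv i))"

fun letter_image :: "endo \<Rightarrow> letter \<Rightarrow> word" where
  "letter_image \<sigma> (Gen i) = \<sigma> i"
| "letter_image \<sigma> (Inv i) = inv_word (\<sigma> i)"

definition apply_endo :: "endo \<Rightarrow> word \<Rightarrow> word" where
  "apply_endo \<sigma> w = reduce (concat (map (letter_image \<sigma>) w))"

fun abel_letter :: "letter \<Rightarrow> int ^ 2" where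
  "abel_letter (Gen i) = axis i 1"
| "abel_letter (Inv i) = - axis i 1"

definition abel :: "word \<Rightarrow> int ^ 2" where
  "abel w = sum_list (map abel_letter w)"

definition endo_matrix :: "endo \<Rightarrow> int ^ 2 ^ 2" where
  "endo_matrix \<sigma> = (\<chi> i j. abel (\<sigma> j) $ i)"


section \<open>The three families of automorphisms\<close>

datatype family = F1 | F2 | F4

fun admissible :: "family \<Rightarrow> int \<Rightarrow> bool" where
  "admissible F1 a \<longleftrightarrow> a \<ge> 3"
| "admissible F2 a \<longleftrightarrow> a \<le> - 3"
| "admissible F4 a \<longleftrightarrow> a \<le> - 1"

fun sigma :: "family \<Rightarrow> int \<Rightarrow> endo" where
  "sigma F1 a i = (if i = 1 then [Gen 2] else gen_power 2 (a - 2) @ [Inv 1, Gen 2, Gen 2])"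
| "sigma F2 a i = (if i = 1 then [Gen 2] else [Inv 1] @ gen_power 2 a)"
| "sigma F4 a i = (if i = 1 then [Gen 2] else [Gen 1] @ gen_power 2 a)"

definition eps :: "family \<Rightarrow> 2 \<Rightarrow> int" where
  "eps t i = (if t \<noteq> F2 \<and> i = 1 then - 1 else 1)"

definition signed_letter :: "family \<Rightarrow> 2 \<Rightarrow> letter" where
  "signed_letter t i = (if eps t i = 1 then Gen i else Inv i)"

lemma reduced_sigma:
  assumes "admissible t a"
  shows "reduced (sigma t a i)"
proof -
  have rep: "successively (\<lambda>l m. m \<noteq> inv_letter l) (replicate n l)" for n l
  proof (induction n)
    case (Suc n)
    then show ?case by (cases l; cases n) auto
  qed simp
  show ?thesis
    using assms
    by (cases t)
       (auto simp: reduced_def gen_power_def successively_append_iff successively_Cons rep)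
qed


section \<open>The one-sided sequences\<close>

text \<open>
  Finite and infinite words are compared as elements of a countable product of discrete spaces;
  finite words are extended by the blank symbol \<^term>\<open>None\<close>.
\<close>

definition padded :: "word \<Rightarrow> nat \<Rightarrow> letter option" where
  "padded w k = (if k < length w then Some (w ! k) else None)"

definition word_limit :: "(nat \<Rightarrow> word) \<Rightarrow> nat \<Rightarrow> letter" where
  "word_limit ws = (THE s. limitin (product_topology (\<lambda>_. discrete_topology UNIV) UNIV)
                             (\<lambda>n. padded (ws n)) (\<lambda>k. Some (s k)) sequentially)"

definition omega :: "family \<Rightarrow> int \<Rightarrow> nat \<Rightarrow> letter" where
  "omega t a = word_limit
     (\<lambda>n. (apply_endo (sigma t a) ^^ (if t = F1 then n else 2 * n)) [Gen 2])"

definition word_prefix :: "(nat \<Rightarrow> letter) \<Rightarrow> nat \<Rightarrow> word" where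
  "word_prefix s k = map s [0..<k]"


section \<open>Tiling substitutions\<close>

text \<open>The basis element \<open>frag_of (x, i)\<close> is the symbol \<open>(x, i\<^sup>*)\<close>.\<close>

type_synonym tiles = "((int ^ 2) \<times> 2) \<Rightarrow>\<^sub>0 int"

definition tile_image :: "endo \<Rightarrow> ((int ^ 2) \<times> 2) \<Rightarrow> tiles" where
  "tile_image \<sigma> = (\<lambda>(x, i). \<Sum>j\<in>UNIV.
     (\<Sum>k | k < length (\<sigma> j) \<and> \<sigma> j ! k = Gen i.
        frag_of (matrix_inv (endo_matrix \<sigma>) *v (x + abel (drop (Suc k) (\<sigma> j))), j))
   - (\<Sum>k | k < length (\<sigma> j) \<and> \<sigma> j ! k = Inv i.
        frag_of (matrix_inv (endo_matrix \<sigma>) *v (x + abel (drop k (\<sigma> j))), j)))"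

definition tile_subst :: "endo \<Rightarrow> tiles \<Rightarrow> tiles" where
  "tile_subst \<sigma> = frag_extend (tile_image \<sigma>)"

definition embed :: "int ^ 2 \<Rightarrow> real ^ 2" where
  "embed x = (\<chi> i. of_int (x $ i))"

text \<open>The segment of \<open>(x, i\<^sup>*)\<close> points in the direction of the other basis vector.\<close>

definition segment :: "(int ^ 2) \<times> 2 \<Rightarrow> (real ^ 2) set" where
  "segment = (\<lambda>(x, i). {embed x + s *\<^sub>R axis (if i = 1 then 2 else 1) 1 | s. 0 \<le> s \<and> s \<le> 1})"

definition realize :: "tiles \<Rightarrow> (real ^ 2) set" where
  "realize g = (\<Union>b\<in>Poly_Mapping.keys g. segment b)"


section \<open>Eigenlines and the projection\<close>

definition real_matrix :: "endo \<Rightarrow> real ^ 2 ^ 2" where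
  "real_matrix \<sigma> = (\<chi> i j. of_int (endo_matrix \<sigma> $ i $ j))"

definition eigenspace :: "real ^ 2 ^ 2 \<Rightarrow> real \<Rightarrow> (real ^ 2) set" where
  "eigenspace A c = {v. A *v v = c *\<^sub>R v}"

definition is_eigenvalue :: "real ^ 2 ^ 2 \<Rightarrow> real \<Rightarrow> bool" where
  "is_eigenvalue A c \<longleftrightarrow> (\<exists>v. v \<noteq> 0 \<and> A *v v = c *\<^sub>R v)"

definition expanding_line :: "endo \<Rightarrow> (real ^ 2) set" where
  "expanding_line \<sigma> = eigenspace (real_matrix \<sigma>)
     (THE c. is_eigenvalue (real_matrix \<sigma>) c \<and> \<bar>c\<bar> > 1)"

definition contracting_line :: "endo \<Rightarrow> (real ^ 2) set" where
  "contracting_line \<sigma> = eigenspace (real_matrix \<sigma>)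
     (THE c. is_eigenvalue (real_matrix \<sigma>) c \<and> \<bar>c\<bar> < 1)"

definition proj :: "endo \<Rightarrow> real ^ 2 \<Rightarrow> real ^ 2" where
  "proj \<sigma> v = (THE p. p \<in> contracting_line \<sigma> \<and> v - p \<in> expanding_line \<sigma>)"


section \<open>Rauzy fractals\<close>

definition hausdorff_dist :: "'a::metric_space set \<Rightarrow> 'a set \<Rightarrow> real" where
  "hausdorff_dist S T = max (SUP x\<in>S. infdist x T) (SUP y\<in>T. infdist y S)"

definition hausdorff_lim :: "(nat \<Rightarrow> 'a::metric_space set) \<Rightarrow> 'a set" where
  "hausdorff_lim S = (THE X. compact X \<and> X \<noteq> {} \<and> (\<lambda>n. hausdorff_dist (S n) X) \<longlonglongrightarrow> 0)"

definition rauzy :: "endo \<Rightarrow> tiles \<Rightarrow> (real ^ 2) set" where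
  "rauzy \<sigma> g = hausdorff_lim
     (\<lambda>n. ((*v) (real_matrix \<sigma>) ^^ n) ` proj \<sigma> ` realize ((tile_subst \<sigma> ^^ n) g))"

text \<open>
  A letter of sign 1 starts from the tile at \<open>e\<^sub>i\<close> and a letter of sign -1 from the tile at 0;
  the primed fractals use the opposite choice.
\<close>

definition base_tile :: "family \<Rightarrow> 2 \<Rightarrow> tiles" where
  "base_tile t i = frag_of (if eps t i = 1 then axis i 1 else 0, i)"

definition base_tile' :: "family \<Rightarrow> 2 \<Rightarrow> tiles" where
  "base_tile' t i = frag_of (if eps t i = 1 then 0 else axis i 1, i)"

definition X_total :: "family \<Rightarrow> int \<Rightarrow> (real ^ 2) set" where
  "X_total t a = rauzy (sigma t a) (base_tile t 1 + base_tile t 2)"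

definition X_part :: "family \<Rightarrow> int \<Rightarrow> 2 \<Rightarrow> (real ^ 2) set" where
  "X_part t a i = rauzy (sigma t a) (base_tile t i)"

definition X_part' :: "family \<Rightarrow> int \<Rightarrow> 2 \<Rightarrow> (real ^ 2) set" where
  "X_part' t a i = rauzy (sigma t a) (base_tile' t i)"


section \<open>Projected prefix points\<close>

definition prefix_point :: "family \<Rightarrow> int \<Rightarrow> nat \<Rightarrow> real ^ 2" where
  "prefix_point t a k = - proj (sigma t a) (embed (abel (word_prefix (omega t a) k)))"

definition Y_total :: "family \<Rightarrow> int \<Rightarrow> (real ^ 2) set" where
  "Y_total t a = range (\<lambda>k. prefix_point t a (Suc k))"

definition Y_part :: "family \<Rightarrow> int \<Rightarrow> 2 \<Rightarrow> (real ^ 2) set" where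
  "Y_part t a i = {prefix_point t a k | k. omega t a k = signed_letter t i}"

definition Y_part' :: "family \<Rightarrow> int \<Rightarrow> 2 \<Rightarrow> (real ^ 2) set" where
  "Y_part' t a i = {prefix_point t a (Suc k) | k. omega t a k = signed_letter t i}"

end

theory Submission
  imports Defs "HOL-Library.Sublist"
begin

text \<open>
  By the chain rule of Fox calculus, the \<open>n\<close>-th iterate of the tiling substitution maps the tile
  \<open>(x, i\<^sup>*)\<close> to the tiles \<open>(A\<^sup>-\<^sup>n (x + f(S)), j\<^sup>*)\<close>, where \<open>S\<close> runs through the suffixes of the reduced
  word \<open>\<sigma>\<^sup>n(j)\<close> at the occurrences of the letter \<open>i\<close>. After projection and renormalization these
  become, up to an error of order \<open>\<mu>\<^sup>n\<close> (\<open>\<mu>\<close> the contracting eigenvalue), the points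
  \<open>-\<pi>(f(P))\<close> for the prefixes \<open>P\<close> of \<open>\<sigma>\<^sup>n(j)\<close>. Conjugation with \<open>\<delta>\<close> shows that \<open>\<sigma>\<^sup>n(2)\<close> or its inverse is
  a word \<open>W\<^sub>n\<close> over the two signed letters, and \<open>\<sigma>\<^sup>n(1) = \<sigma>\<^sup>n\<^sup>-\<^sup>1(2)\<close>. Each \<open>W\<^sub>n\<close> is a prefix of
  \<open>\<omega>\<close> or occurs in \<open>\<omega>\<close> after a prefix whose projection is of order \<open>\<mu>\<^sup>n\<close>, and every prefix of \<open>\<omega>\<close>
  is a prefix of \<open>W\<^sub>n\<close> for large \<open>n\<close>. So the projected tiles and the prefix points approximate each
  other. The prefix points are bounded, since a prefix of \<open>W\<^sub>n\<^sub>+\<^sub>1\<close> is, up to a bounded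
  factor, the image of a piece of \<open>W\<^sub>n\<close>, and the substitution contracts by \<open>\<mu>\<close>.
\<close>

section \<open>Hausdorff limits\<close>

text \<open>A real supremum dominates its terms only when they are bounded above; boundedness of
  \<open>S\<close> supplies this.\<close>

lemma infdist_le_hausdorff_dist:
  assumes "bounded S" "T \<noteq> {}" "x \<in> S"
  shows "infdist x T \<le> hausdorff_dist S T"
proof -
  obtain z where z: "z \<in> T" using assms by auto
  obtain e where e: "\<And>s. s \<in> S \<Longrightarrow> dist z s \<le> e"
    using assms(1) bounded_any_center by blast
  have "bdd_above ((\<lambda>x. infdist x T) ` S)"
    using infdist_le[OF z] e by (intro bdd_aboveI2[where M = e]) (metis dist_commute order_trans)
  then have "infdist x T \<le> (SUP x\<in>S. infdist x T)"
    using assms(3) by (rule cSUP_upper2) simp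
  then show ?thesis by (simp add: hausdorff_dist_def)
qed

lemma infdist_lessE:
  assumes "infdist x S < e" "S \<noteq> {}"
  obtains y where "y \<in> S" "dist x y < e"
proof -
  have "e \<le> infdist x S" if "\<And>y. y \<in> S \<Longrightarrow> e \<le> dist x y"
    unfolding infdist_notempty[OF assms(2)] using assms(2) that by (rule cINF_greatest)
  with assms(1) that show thesis by (meson not_less)
qed

lemma hausdorff_dist_commute: "hausdorff_dist S T = hausdorff_dist T S"
  by (simp add: hausdorff_dist_def max.commute)

text \<open>Half of the uniqueness needed to evaluate the description in
  \<open>hausdorff_lim\<close>: a point of \<open>X\<close> is close to some point of
  \<open>S n\<close>, which is close to \<open>X'\<close>, and \<open>X'\<close> is closed.\<close>

lemma hausdorff_limit_subset:
  assumes bdd: "\<forall>\<^sub>F n in sequentially. bounded (S n) \<and> S n \<noteq> {}"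
    and X: "compact X" "X \<noteq> {}" "(\<lambda>n. hausdorff_dist (S n) X) \<longlonglongrightarrow> 0"
    and X': "compact X'" "X' \<noteq> {}" "(\<lambda>n. hausdorff_dist (S n) X') \<longlonglongrightarrow> 0"
  shows "X \<subseteq> X'"
proof
  fix x assume x: "x \<in> X"
  have "infdist x X' \<le> e" if "e > 0" for e
  proof -
    have "\<forall>\<^sub>F n in sequentially. hausdorff_dist (S n) X < e / 2"
      "\<forall>\<^sub>F n in sequentially. hausdorff_dist (S n) X' < e / 2"
      using order_tendstoD(2)[OF X(3), of "e / 2"] order_tendstoD(2)[OF X'(3), of "e / 2"] that
      by simp_all
    with bdd have "\<forall>\<^sub>F n in sequentially. bounded (S n) \<and> S n \<noteq> {} \<and>
        hausdorff_dist (S n) X < e / 2 \<and> hausdorff_dist (S n) X' < e / 2"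
      by eventually_elim simp
    from eventually_happens'[OF sequentially_bot this]
    obtain n where n: "bounded (S n)" "S n \<noteq> {}"
        "hausdorff_dist (S n) X < e / 2" "hausdorff_dist (S n) X' < e / 2"
      by blast
    have "infdist x (S n) < e / 2"
      using infdist_le_hausdorff_dist[of X "S n" x] n x X(1)
      by (simp add: compact_imp_bounded hausdorff_dist_commute)
    then obtain y where y: "y \<in> S n" "dist x y < e / 2"
      by (rule infdist_lessE[OF _ n(2)])
    have "infdist y X' < e / 2"
      using infdist_le_hausdorff_dist[of "S n" X' y] n y X'(2) by simp
    then show ?thesis
      using infdist_triangle[of x X' y] y(2) by simp
  qed
  then have "infdist x X' = 0"
    by (metis dense_ge infdist_nonneg order_antisym)
  then show "x \<in> X'"
    using X' by (simp add: in_closed_iff_infdist_zero compact_imp_closed)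
qed

lemma hausdorff_dist_le:
  assumes "S \<noteq> {}" "T \<noteq> {}"
    and "\<And>x. x \<in> S \<Longrightarrow> infdist x T \<le> e" "\<And>y. y \<in> T \<Longrightarrow> infdist y S \<le> e"
  shows "hausdorff_dist S T \<le> e"
  using assms by (auto simp: hausdorff_dist_def intro!: cSUP_least)

lemma hausdorff_dist_nonneg:
  assumes "bounded S" "S \<noteq> {}" "T \<noteq> {}"
  shows "0 \<le> hausdorff_dist S T"
  using assms infdist_le_hausdorff_dist[of S T] infdist_nonneg
  by (metis all_not_in_conv order_trans)

text \<open>The two hypotheses differ in strength: \<open>near_Y\<close> is uniform over
  \<open>S n\<close>, \<open>near_S\<close> holds only point by point. Compactness of
  \<open>closure Y\<close> makes the second uniform.\<close>

lemma hausdorff_lim_eq_closure: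
  fixes Y :: "'a::heine_borel set"
  assumes Y: "bounded Y" "Y \<noteq> {}"
    and near_Y: "\<And>e. e > 0 \<Longrightarrow> \<forall>\<^sub>F n in sequentially. \<forall>x\<in>S n. \<exists>y\<in>Y. dist x y < e"
    and near_S: "\<And>y e. y \<in> Y \<Longrightarrow> e > 0 \<Longrightarrow> \<forall>\<^sub>F n in sequentially. \<exists>x\<in>S n. dist x y < e"
  shows "hausdorff_lim S = closure Y"
proof -
  let ?X = "closure Y"
  have X: "compact ?X" "?X \<noteq> {}"
    using Y by (auto simp: compact_closure)
  obtain y0 where y0: "y0 \<in> Y" using Y by auto
  have ne: "\<forall>\<^sub>F n in sequentially. S n \<noteq> {}"
    using near_S[OF y0 zero_less_one] by eventually_elim auto
  obtain b where b: "\<And>y. y \<in> Y \<Longrightarrow> dist y0 y \<le> b"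
    using Y(1) bounded_any_center by blast
  have "\<forall>\<^sub>F n in sequentially. bounded (S n)"
    using near_Y[OF zero_less_one]
  proof eventually_elim
    case (elim n)
    have "dist y0 x \<le> b + 1" if x: "x \<in> S n" for x
    proof -
      obtain y where "y \<in> Y" "dist x y < 1" using elim x by blast
      then show ?thesis using b[of y] dist_triangle[of y0 x y] by (simp add: dist_commute)
    qed
    then show ?case by (auto simp: bounded_def)
  qed
  with ne have bdd: "\<forall>\<^sub>F n in sequentially. bounded (S n) \<and> S n \<noteq> {}"
    by eventually_elim simp
  have "(\<lambda>n. hausdorff_dist (S n) ?X) \<longlonglongrightarrow> 0"
  proof (rule tendstoI)
    fix e :: real assume e: "e > 0"
    \<comment> \<open>A finite e/4-net taken from \<open>Y\<close> itself, so that
      \<open>near_S\<close> applies to its members; the detour through it costs e/2 in all.\<close>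
    obtain F where F: "F \<subseteq> Y" "finite F" "?X \<subseteq> (\<Union>x\<in>F. ball x (e / 4))"
    proof -
      have "?X \<subseteq> (\<Union>x\<in>Y. ball x (e / 4))"
        using e closure_approachable[of _ Y] by (fastforce dest: spec[of _ "e / 4"])
      then show ?thesis
        using compactE_image[OF X(1), of Y "\<lambda>x. ball x (e / 4)"] that by (metis open_ball)
    qed
    have "\<forall>\<^sub>F n in sequentially. \<forall>y\<in>F. \<exists>x\<in>S n. dist x y < e / 4"
      using F(1,2) e by (intro eventually_ball_finite ballI near_S) auto
    moreover have "\<forall>\<^sub>F n in sequentially. \<forall>x\<in>S n. \<exists>y\<in>Y. dist x y < e / 2"
      using e by (intro near_Y) simp
    ultimately show "\<forall>\<^sub>F n in sequentially. dist (hausdorff_dist (S n) ?X) 0 < e"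
      using bdd
    proof eventually_elim
      case (elim n)
      have "hausdorff_dist (S n) ?X \<le> e / 2"
      proof (rule hausdorff_dist_le)
        fix x assume "x \<in> S n"
        then obtain y where "y \<in> Y" "dist x y < e / 2" using elim by auto
        then show "infdist x ?X \<le> e / 2"
          using closure_subset by (meson infdist_le2 less_imp_le subsetD)
      next
        fix z assume "z \<in> ?X"
        then obtain y where y: "y \<in> F" "dist y z < e / 4" using F(3) by auto
        then obtain x where x: "x \<in> S n" "dist x y < e / 4" using elim by auto
        have "dist z x \<le> e / 2"
          using dist_triangle[of z x y] x y by (simp add: dist_commute)
        then show "infdist z (S n) \<le> e / 2"
          using x(1) by (rule infdist_le2[rotated])
      qed (use elim X in auto)
      moreover have "0 \<le> hausdorff_dist (S n) ?X"
        using elim X by (intro hausdorff_dist_nonneg) auto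
      ultimately show ?case using e by simp
    qed
  qed
  with X have lim: "compact ?X \<and> ?X \<noteq> {} \<and> (\<lambda>n. hausdorff_dist (S n) ?X) \<longlonglongrightarrow> 0"
    by simp
  show ?thesis
    unfolding hausdorff_lim_def
  proof (rule the_equality)
    show "compact ?X \<and> ?X \<noteq> {} \<and> (\<lambda>n. hausdorff_dist (S n) ?X) \<longlonglongrightarrow> 0"
      by (fact lim)
  next
    fix X' assume "compact X' \<and> X' \<noteq> {} \<and> (\<lambda>n. hausdorff_dist (S n) X') \<longlonglongrightarrow> 0"
    with lim show "X' = ?X"
      using hausdorff_limit_subset[OF bdd, of X' ?X] hausdorff_limit_subset[OF bdd, of ?X X']
      by (intro equalityI) simp_all
  qed
qed


section \<open>Reduction in the free group\<close>

lemma inv_letter_inv_letter [simp]: "inv_letter (inv_letter l) = l"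
  by (cases l) auto

lemma inv_word_Nil [simp]: "inv_word [] = []"
  and inv_word_Cons: "inv_word (l # w) = inv_word w @ [inv_letter l]"
  and inv_word_append: "inv_word (u @ v) = inv_word v @ inv_word u"
  and inv_word_inv_word [simp]: "inv_word (inv_word w) = w"
  by (simp_all add: inv_word_def rev_map comp_def)

lemma reduced_Cons: "reduced (l # w) \<longleftrightarrow> reduced w \<and> (w = [] \<or> hd w \<noteq> inv_letter l)"
  by (cases w) (auto simp: reduced_def)

lemma reduced_inv_word: "reduced w \<Longrightarrow> reduced (inv_word w)"
proof -
  have eq: "(inv_letter x \<noteq> inv_letter (inv_letter y)) = (y \<noteq> inv_letter x)" for x y
    by (cases x; cases y) auto
  assume "reduced w"
  then show ?thesis
    unfolding reduced_def inv_word_def successively_rev successively_map eq .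
qed

lemma reduced_push: "reduced w \<Longrightarrow> reduced (push l w)"
  by (cases w) (auto simp: reduced_def successively_Cons)

lemma reduced_reduce: "reduced (reduce w)"
  by (induction w) (simp_all add: reduce_def reduced_push, simp add: reduced_def)

lemma reduced_foldr_push: "reduced w \<Longrightarrow> reduced (foldr push u w)"
  by (induction u) (auto simp: reduced_push)

text \<open>Each letter acts on reduced words by a bijection whose inverse is the action of the
  inverse letter. This is the source of the independence of reduction from the order of
  cancellations.\<close>

lemma push_inv_letter_push: "reduced w \<Longrightarrow> push l (push (inv_letter l) w) = w"
  by (cases w rule: remdups_adj.cases) (auto simp: reduced_def)

lemma reduce_reduced: "reduced w \<Longrightarrow> reduce w = w"
proof (induction w)
  case (Cons l w)
  then show ?case by (cases w) (auto simp: reduce_def reduced_def)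
qed (simp add: reduce_def)

lemma foldr_push_push:
  "reduced r \<Longrightarrow> foldr push (push l u) r = push l (foldr push u r)"
  by (cases u) (auto simp: push_inv_letter_push reduced_foldr_push)

lemma foldr_push_reduce: "reduced r \<Longrightarrow> foldr push (reduce u) r = foldr push u r"
  by (induction u) (simp_all add: reduce_def foldr_push_push)

lemma reduce_append: "reduce (u @ v) = reduce (reduce u @ reduce v)"
proof -
  have "reduce (u @ v) = foldr push (reduce u) (reduce v)"
    by (simp add: reduce_def[of "u @ v"] foldr_push_reduce[OF reduced_reduce]
        reduce_def[of v, symmetric])
  also have "reduce v = foldr push (reduce v) []"
    using reduce_reduced[OF reduced_reduce, of v] by (simp add: reduce_def)
  finally show ?thesis by (simp add: reduce_def)
qed

lemma reduce_concat_cong: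
  assumes "\<And>x. x \<in> set xs \<Longrightarrow> reduce (f x) = reduce (g x)"
  shows "reduce (concat (map f xs)) = reduce (concat (map g xs))"
  using assms
proof (induction xs)
  case (Cons x xs)
  then show ?case
    using reduce_append[of "f x" "concat (map f xs)"] reduce_append[of "g x" "concat (map g xs)"]
    by simp
qed simp

lemma reduce_inv_word: "reduce (inv_word w) = inv_word (reduce w)"
proof (induction w)
  case (Cons l w)
  let ?r = "reduce w"
  have "reduce (inv_word (l # w)) = reduce (inv_word ?r @ [inv_letter l])"
    using reduce_append[of "inv_word w" "[inv_letter l]"] reduce_append[of "inv_word ?r" "[inv_letter l]"]
      Cons reduce_reduced[OF reduced_inv_word[OF reduced_reduce[of w]]]
    by (simp add: inv_word_Cons)
  also have "\<dots> = inv_word (push l ?r)"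
  \<comment> \<open>If \<open>push\<close> cancels \<open>l\<close> at the front of
    \<open>?r\<close>, the same pair cancels at the end of the inverse; otherwise both sides are
    already reduced.\<close>
  proof (cases "?r \<noteq> [] \<and> hd ?r = inv_letter l")
    case True
    then obtain z where z: "?r = inv_letter l # z" by (cases ?r) auto
    have "reduced z" using reduced_reduce[of w] z by (simp add: reduced_Cons)
    moreover have "reduce [l, inv_letter l] = []" by (simp add: reduce_def)
    ultimately show ?thesis
      using z reduce_append[of "inv_word z" "[l, inv_letter l]"]
      by (simp add: inv_word_Cons reduce_reduced reduced_inv_word)
  next
    case False
    then have "reduced (l # ?r)" by (auto simp: reduced_Cons reduced_reduce)
    moreover have "push l ?r = l # ?r" using False by (cases ?r) auto
    ultimately show ?thesis
      using reduce_reduced[OF reduced_inv_word, of "l # ?r"] by (simp add: inv_word_Cons)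
  qed
  finally show ?case by (simp add: reduce_def)
qed (simp add: reduce_def)

lemma letter_image_inv_letter: "letter_image \<sigma> (inv_letter l) = inv_word (letter_image \<sigma> l)"
  by (cases l) auto

lemma concat_map_letter_image_inv_word:
  "concat (map (letter_image \<sigma>) (inv_word w)) = inv_word (concat (map (letter_image \<sigma>) w))"
  by (induction w) (simp_all add: inv_word_Cons inv_word_append letter_image_inv_letter)

lemma apply_endo_inv_word: "apply_endo \<sigma> (inv_word w) = inv_word (apply_endo \<sigma> w)"
  by (simp add: apply_endo_def concat_map_letter_image_inv_word reduce_inv_word)


section \<open>Iterated tiling substitutions by Fox calculus\<close>

lemma abel_Nil [simp]: "abel [] = 0"
  and abel_Cons [simp]: "abel (l # w) = abel_letter l + abel w"
  and abel_append [simp]: "abel (u @ v) = abel u + abel v"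
  by (simp_all add: abel_def)

lemma abel_letter_inv_letter [simp]: "abel_letter (inv_letter l) = - abel_letter l"
  by (cases l) auto

lemma abel_inv_word [simp]: "abel (inv_word w) = - abel w"
  by (induction w) (simp_all add: inv_word_Cons)

lemma abel_push: "abel (push l w) = abel (l # w)"
  by (cases w) auto

lemma abel_reduce [simp]: "abel (reduce w) = abel w"
  by (induction w) (simp_all add: reduce_def abel_push)

lemma endo_matrix_mult_axis: "endo_matrix \<sigma> *v axis i 1 = abel (\<sigma> i)"
  by (simp add: vec_eq_iff matrix_vector_mult_def endo_matrix_def axis_def if_distrib sum.delta
      cong: if_cong)

lemma abel_letter_image: "abel (letter_image \<sigma> l) = endo_matrix \<sigma> *v abel_letter l"
  using matrix_vector_mult_diff_distrib[of "endo_matrix \<sigma>" 0]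
  by (cases l) (simp_all add: endo_matrix_mult_axis)

lemma abel_apply_endo: "abel (apply_endo \<sigma> w) = endo_matrix \<sigma> *v abel w"
  unfolding apply_endo_def abel_reduce
  by (induction w) (simp_all add: abel_letter_image matrix_vector_right_distrib)

text \<open>
  The Fox derivative with respect to the letter \<open>i\<close>, with values in the group ring of the
  abelianization, written with suffixes instead of prefixes. It is the coefficient of
  the tiling substitution, and its chain rule makes the substitution contravariantly functorial.
\<close>

fun fox :: "2 \<Rightarrow> word \<Rightarrow> (int ^ 2 \<Rightarrow>\<^sub>0 int)" where
  "fox i [] = 0"
| "fox i (Gen j # w) = (if i = j then frag_of (abel w) else 0) + fox i w"
| "fox i (Inv j # w) = - (if i = j then frag_of (abel (Inv j # w)) else 0) + fox i w"

lemma frag_of_mult: "frag_of x * frag_of y = frag_of (x + y)"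
  by (simp add: mult_single)

text \<open>Product rule: appending \<open>v\<close> extends each suffix that starts in
  \<open>u\<close>, which in the commutative group ring is multiplication by the class of
  \<open>v\<close>.\<close>

lemma fox_append: "fox i (u @ v) = fox i u * frag_of (abel v) + fox i v"
  by (induction i u rule: fox.induct) (simp_all add: algebra_simps frag_of_mult)

text \<open>An inverse letter is recorded with itself included in the suffix, a positive one without
  itself. Hence an adjacent cancelling pair contributes the same group element with opposite
  signs.\<close>

lemma fox_push: "fox i (push l w) = fox i (l # w)"
proof (cases w)
  case (Cons m v)
  then show ?thesis by (cases l; cases m) auto
qed simp

lemma fox_reduce: "fox i (reduce w) = fox i w"
proof (induction w)
  case (Cons l w)
  have "fox i (l # reduce w) = fox i (l # w)"
    using Cons by (cases l) simp_all
  then show ?case by (simp add: reduce_def fox_push)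
qed (simp add: reduce_def)

text \<open>The product rule forces this value, because the derivative of a word times its inverse
  is zero after cancellation.\<close>

lemma fox_inv_word: "fox i (inv_word w) = - fox i w * frag_of (- abel w)"
proof (induction w)
  case (Cons l w)
  define X Y Z where "X = frag_of (abel w)" and "Y = frag_of (- abel w)"
    and "Z = frag_of (- abel_letter l)"
  have XY: "X * Y = 1" and YZ: "frag_of (- abel (l # w)) = Y * Z"
    by (simp_all add: X_def Y_def Z_def frag_of_mult frag_of_eq)
  have l: "fox i [inv_letter l] = - fox i [l] * Z"
    by (cases l) (simp_all add: frag_of_mult Z_def)
  have Z: "frag_of (abel [inv_letter l]) = Z"
    by (simp add: Z_def)
  have "fox i (l # w) * (Y * Z) = (fox i [l] * X + fox i w) * (Y * Z)"
    using fox_append[of i "[l]" w] by (simp add: X_def)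
  also have "\<dots> = fox i [l] * Z * (X * Y) + fox i w * Y * Z"
    by (simp only: algebra_simps)
  finally show ?case
    by (simp add: inv_word_Cons fox_append Cons l Z YZ XY Y_def[symmetric]
        del: abel_Cons fox.simps)
qed simp

section \<open>Change of exponents in the group ring, and the chain rule\<close>

definition pushforward :: "('a \<Rightarrow> 'b) \<Rightarrow> ('a \<Rightarrow>\<^sub>0 int) \<Rightarrow> ('b \<Rightarrow>\<^sub>0 int)" where
  "pushforward h = frag_extend (\<lambda>x. frag_of (h x))"

lemma pushforward_0 [simp]: "pushforward h 0 = 0"
  and pushforward_add: "pushforward h (p + q) = pushforward h p + pushforward h q"
  and pushforward_diff: "pushforward h (p - q) = pushforward h p - pushforward h q"
  and pushforward_frag_of [simp]: "pushforward h (frag_of x) = frag_of (h x)"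
  by (simp_all add: pushforward_def frag_extend_add frag_extend_diff)

lemma pushforward_sum: "finite I \<Longrightarrow> pushforward h (\<Sum>i\<in>I. p i) = (\<Sum>i\<in>I. pushforward h (p i))"
  by (simp add: pushforward_def frag_extend_sum comp_def)

lemma pushforward_compose: "pushforward g (pushforward h p) = pushforward (\<lambda>x. g (h x)) p"
  unfolding pushforward_def by (induction p rule: frag_induction[OF subset_UNIV])
    (simp_all add: frag_extend_diff)

lemma pushforward_mult:
  assumes h: "\<And>x y. h (x + y) = h x + h y"
  shows "pushforward h (p * q) = pushforward h p * pushforward h q"
proof (induction p rule: frag_induction[OF subset_UNIV])
  case (2 x)
  show ?case
    by (induction q rule: frag_induction[OF subset_UNIV])
      (simp_all add: frag_of_mult h pushforward_diff right_diff_distrib)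
qed (simp_all add: pushforward_diff left_diff_distrib)

lemma lookup_pushforward:
  assumes "\<And>x. g (h x) = x" "\<And>y. h (g y) = y"
  shows "Poly_Mapping.lookup (pushforward h p) y = Poly_Mapping.lookup p (g y)"
proof (induction p rule: frag_induction[OF subset_UNIV])
  case (2 x)
  show ?case using assms by (auto simp: )
qed (simp_all add: pushforward_diff lookup_minus)

text \<open>Chain rule: each letter of the unreduced image lies in the image of one letter of
  \<open>w\<close>, and what follows that image abelianizes to the matrix applied to what follows
  the letter. Reduction is harmless by \<open>fox_reduce\<close>.\<close>

lemma fox_apply_endo:
  "fox i (apply_endo \<sigma> w)
    = (\<Sum>j\<in>UNIV. fox i (\<sigma> j) * pushforward ((*v) (endo_matrix \<sigma>)) (fox j w))"
proof -
  let ?A = "(*v) (endo_matrix \<sigma>)"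
  have rest: "abel (concat (map (letter_image \<sigma>) w)) = ?A (abel w)" for w
    using abel_apply_endo[of \<sigma> w] by (simp add: apply_endo_def)
  have "fox i (concat (map (letter_image \<sigma>) w))
    = (\<Sum>j\<in>UNIV. fox i (\<sigma> j) * pushforward ?A (fox j w))"
  proof (induction w)
    case (Cons l w)
    let ?c = "concat (map (letter_image \<sigma>) w)"
    have IH: "fox i (concat (map (letter_image \<sigma>) (l # w)))
      = fox i (letter_image \<sigma> l) * frag_of (?A (abel w))
        + (\<Sum>j\<in>UNIV. fox i (\<sigma> j) * pushforward ?A (fox j w))"
      using Cons by (simp add: fox_append rest)
    show ?case
    proof (cases l)
      case (Gen m)
      have "(\<Sum>j\<in>UNIV. fox i (\<sigma> j) * pushforward ?A (fox j (l # w)))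
        = (\<Sum>j\<in>UNIV. (if j = m then fox i (\<sigma> j) * frag_of (?A (abel w)) else 0)
            + fox i (\<sigma> j) * pushforward ?A (fox j w))"
        by (intro sum.cong) (auto simp: Gen pushforward_add distrib_left)
      then show ?thesis
        using IH by (simp add: Gen sum.distrib)
    next
      case (Inv m)
      have "(\<Sum>j\<in>UNIV. fox i (\<sigma> j) * pushforward ?A (fox j (l # w)))
        = (\<Sum>j\<in>UNIV. (if j = m then - (fox i (\<sigma> j) * frag_of (?A (abel (Inv m # w)))) else 0)
            + fox i (\<sigma> j) * pushforward ?A (fox j w))"
        by (intro sum.cong) (auto simp: Inv pushforward_diff algebra_simps)
      \<comment> \<open>The factor from the inverse rule moves the class of the image of
        \<open>w\<close> to that of the suffix that includes the inverse letter.\<close>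
      moreover have "frag_of (?A (abel (Inv m # w))) = frag_of (- abel (\<sigma> m)) * frag_of (?A (abel w))"
        by (simp only: frag_of_mult abel_Cons matrix_vector_right_distrib abel_letter_image[symmetric]
            letter_image.simps abel_inv_word)
      ultimately show ?thesis
        using IH by (simp add: Inv sum.distrib fox_inv_word mult.assoc)
    qed
  qed simp
  then show ?thesis by (simp add: apply_endo_def fox_reduce)
qed

lemma fox_conv_sum:
  "fox i w = (\<Sum>k | k < length w \<and> w ! k = Gen i. frag_of (abel (drop (Suc k) w)))
    - (\<Sum>k | k < length w \<and> w ! k = Inv i. frag_of (abel (drop k w)))"
proof (induction w)
  case (Cons l w)
  have split: "(\<Sum>k | k < length (l # w) \<and> (l # w) ! k = m. f k)
      = (if l = m then f 0 else 0) + (\<Sum>k | k < length w \<and> w ! k = m. f (Suc k))"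
    for m and f :: "nat \<Rightarrow> int ^ 2 \<Rightarrow>\<^sub>0 int"
  proof -
    have eq: "{k. k < length (l # w) \<and> (l # w) ! k = m}
      = (if l = m then {0} else {}) \<union> Suc ` {k. k < length w \<and> w ! k = m}"
      by (auto simp: image_iff less_Suc_eq_0_disj)
    show ?thesis
      unfolding eq by (subst sum.union_disjoint) (auto simp: sum.reindex)
  qed
  show ?case unfolding split using Cons by (cases l) auto
qed simp

section \<open>Iterates of the tiling substitution in the group ring\<close>

lemma funpow_left_inverse:
  fixes g h :: "'a \<Rightarrow> 'a"
  assumes "\<And>x. g (h x) = x"
  shows "(g ^^ n) ((h ^^ n) x) = x"
proof (induction n)
  case (Suc n)
  have "(g ^^ Suc n) ((h ^^ Suc n) x) = (g ^^ n) (g (h ((h ^^ n) x)))"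
    by (subst funpow_Suc_right) simp
  then show ?case using Suc assms by simp
qed simp

text \<open>Regards the tiles of one type as an element of the group ring of the lattice, so that
  the tiling substitution becomes multiplication by Fox derivatives followed by the inverse matrix
  on exponents.\<close>

definition tile_layer :: "2 \<Rightarrow> (int ^ 2 \<Rightarrow>\<^sub>0 int) \<Rightarrow> tiles" where
  "tile_layer i = pushforward (\<lambda>x. (x, i))"

lemma lookup_tile_layer: "Poly_Mapping.lookup (tile_layer i p) (x, j) = (if j = i then Poly_Mapping.lookup p x else 0)"
  unfolding tile_layer_def
  by (induction p rule: frag_induction[OF subset_UNIV]) (auto simp: pushforward_diff lookup_minus)

lemma tile_subst_0 [simp]: "tile_subst \<sigma> 0 = 0"
  and tile_subst_add: "tile_subst \<sigma> (g + h) = tile_subst \<sigma> g + tile_subst \<sigma> h"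
  and tile_subst_diff: "tile_subst \<sigma> (g - h) = tile_subst \<sigma> g - tile_subst \<sigma> h"
  by (simp_all add: tile_subst_def frag_extend_add frag_extend_diff)

lemma tile_subst_funpow_0: "(tile_subst \<sigma> ^^ n) 0 = 0"
  by (induction n) simp_all

lemma tile_subst_funpow_add:
  "(tile_subst \<sigma> ^^ n) (g + h) = (tile_subst \<sigma> ^^ n) g + (tile_subst \<sigma> ^^ n) h"
  by (induction n) (simp_all add: tile_subst_add)

lemma tile_subst_funpow_sum:
  "finite I \<Longrightarrow> (tile_subst \<sigma> ^^ n) (\<Sum>i\<in>I. g i) = (\<Sum>i\<in>I. (tile_subst \<sigma> ^^ n) (g i))"
  by (induction I rule: finite_induct) (simp_all add: tile_subst_funpow_0 tile_subst_funpow_add)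

lemma tile_subst_tile_layer:
  "tile_subst \<sigma> (tile_layer i p)
    = (\<Sum>j\<in>UNIV. tile_layer j
        (pushforward ((*v) (matrix_inv (endo_matrix \<sigma>))) (p * fox i (\<sigma> j))))"
proof (induction p rule: frag_induction[OF subset_UNIV])
  case (2 x)
  let ?B = "(*v) (matrix_inv (endo_matrix \<sigma>))"
  have "tile_layer j (pushforward ?B (frag_of x * fox i (\<sigma> j)))
    = (\<Sum>k | k < length (\<sigma> j) \<and> \<sigma> j ! k = Gen i. frag_of (?B (x + abel (drop (Suc k) (\<sigma> j))), j))
     - (\<Sum>k | k < length (\<sigma> j) \<and> \<sigma> j ! k = Inv i. frag_of (?B (x + abel (drop k (\<sigma> j))), j))" for j
    by (simp add: fox_conv_sum right_diff_distrib sum_distrib_left tile_layer_def pushforward_diff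
        pushforward_sum frag_of_mult)
  then show ?case
    by (simp add: tile_layer_def tile_subst_def tile_image_def)
qed (simp_all add: tile_layer_def pushforward_diff left_diff_distrib tile_subst_diff sum_subtractf)

context
  fixes \<sigma> :: endo and A B :: "int ^ 2 \<Rightarrow> int ^ 2"
  assumes A_def: "A = (*v) (endo_matrix \<sigma>)" and B_def: "B = (*v) (matrix_inv (endo_matrix \<sigma>))"
    and BA: "\<And>x. B (A x) = x" and AB: "\<And>x. A (B x) = x"
begin

text \<open>Contravariance: one step of \<open>tile_subst\<close> is applied first and the induction
  hypothesis to its result, so that the derivatives combine as in the chain rule for
  \<sigma>^(n+1)(l) = \<sigma>(\<sigma>^n(l)).\<close>

lemma tile_subst_funpow_tile_layer:
  "(tile_subst \<sigma> ^^ n) (tile_layer i p)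
    = (\<Sum>l\<in>UNIV. tile_layer l (pushforward (B ^^ n) (p * fox i ((apply_endo \<sigma> ^^ n) [Gen l]))))"
proof (induction n arbitrary: i p)
  case 0
  have "tile_layer l (p * fox i [Gen l]) = (if l = i then tile_layer l p else 0)" for l
    by (simp add: tile_layer_def)
  moreover have "pushforward (\<lambda>x. x) q = q" for q :: "int ^ 2 \<Rightarrow>\<^sub>0 int"
    by (simp add: pushforward_def frag_expansion[symmetric])
  ultimately show ?case by (simp add: id_def)
next
  case (Suc n)
  have Bn: "pushforward (B ^^ n) (pushforward B q) = pushforward (B ^^ Suc n) q" for q
    by (simp add: pushforward_compose funpow_swap1 comp_def del: funpow.simps)
      (simp add: funpow_swap1 comp_def)
  have mult: "pushforward B (p * q) = pushforward B p * pushforward B q" for p q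
    by (simp add: pushforward_mult B_def matrix_vector_right_distrib)
  have cancel: "pushforward B (pushforward A q) = q" for q
    by (simp add: pushforward_compose BA) (simp add: pushforward_def frag_expansion[symmetric])
  let ?w = "\<lambda>l. (apply_endo \<sigma> ^^ n) [Gen l]"
  have "(tile_subst \<sigma> ^^ Suc n) (tile_layer i p)
    = (\<Sum>j\<in>UNIV. (tile_subst \<sigma> ^^ n) (tile_layer j (pushforward B (p * fox i (\<sigma> j)))))"
    by (simp add: funpow_swap1 tile_subst_tile_layer tile_subst_funpow_sum B_def[symmetric])
  also have "\<dots> = (\<Sum>j\<in>UNIV. \<Sum>l\<in>UNIV. tile_layer l (pushforward (B ^^ n)
      (pushforward B (p * fox i (\<sigma> j)) * fox j (?w l))))"
    by (simp add: Suc)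
  \<comment> \<open>Writing the inner derivative as the push by \<open>B\<close> of its push by
    \<open>A\<close> puts the whole product under one push by \<open>B\<close>; the sum over
    \<open>j\<close> is then the right side of the chain rule.\<close>
  also have "\<dots> = (\<Sum>l\<in>UNIV. tile_layer l (pushforward (B ^^ Suc n)
      (p * (\<Sum>j\<in>UNIV. fox i (\<sigma> j) * pushforward A (fox j (?w l))))))"
    by (subst sum.swap)
      (simp add: Bn[symmetric] sum_distrib_left tile_layer_def pushforward_sum mult cancel
        mult.assoc del: funpow.simps)
  also have "\<dots> = (\<Sum>l\<in>UNIV. tile_layer l
      (pushforward (B ^^ Suc n) (p * fox i ((apply_endo \<sigma> ^^ Suc n) [Gen l]))))"
    by (simp add: fox_apply_endo A_def)
  finally show ?case .
qed

text \<open>Reading the coefficient at A^n z instead of z removes the inverse matrices, since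
  \<open>A ^^ n\<close> undoes \<open>B ^^ n\<close> on exponents.\<close>

lemma lookup_tile_subst_funpow:
  "Poly_Mapping.lookup ((tile_subst \<sigma> ^^ n) (tile_layer i p)) (z, l)
    = Poly_Mapping.lookup (p * fox i ((apply_endo \<sigma> ^^ n) [Gen l])) ((A ^^ n) z)"
proof -
  note inverse = funpow_left_inverse[of A B, OF AB] funpow_left_inverse[of B A, OF BA]
  show ?thesis
    unfolding tile_subst_funpow_tile_layer lookup_sum lookup_tile_layer
    by (simp add: lookup_pushforward[of "A ^^ n" "B ^^ n", OF inverse])
qed

end


section \<open>Tiles and suffixes of signed words\<close>

lemma eps_cases: "eps t i = 1 \<or> eps t i = - 1"
  by (simp add: eps_def)

lemma abel_signed_letter: "abel_letter (signed_letter t i) = eps t i *s axis i 1"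
  using eps_cases[of t i] by (auto simp: signed_letter_def vec_eq_iff)

lemma inj_signed_letter: "inj (signed_letter t)"
  by (auto simp: inj_on_def signed_letter_def split: if_splits)

definition signed_word :: "family \<Rightarrow> word \<Rightarrow> bool" where
  "signed_word t w \<longleftrightarrow> set w \<subseteq> range (signed_letter t)"

text \<open>It follows that distinct suffixes of a signed word have distinct abelianizations, so no tiles cancel.\<close>

lemma abel_signed_word_height:
  assumes "signed_word t w"
  shows "eps t 1 * abel w $ 1 + eps t 2 * abel w $ 2 = int (length w)"
  using assms
proof (induction w)
  case (Cons l w)
  then obtain i where l: "l = signed_letter t i" and w: "signed_word t w"
    by (auto simp: signed_word_def)
  have "eps t j * eps t j = 1" for j
    using eps_cases[of t j] by auto
  then show ?case
    using Cons.IH[OF w] exhaust_2[of i]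
    by (auto simp: l abel_signed_letter axis_def distrib_left mult.assoc[symmetric])
qed simp

text \<open>Records each letter with the suffix that includes it, whatever its sign; the weight
  selects letters and carries their signs.\<close>

primrec suffix_sum :: "(letter \<Rightarrow> int) \<Rightarrow> word \<Rightarrow> (int ^ 2 \<Rightarrow>\<^sub>0 int)" where
  "suffix_sum c [] = 0"
| "suffix_sum c (l # w) = Poly_Mapping.single (abel (l # w)) (c l) + suffix_sum c w"

lemma suffix_sum_sum:
  "finite I \<Longrightarrow> (\<Sum>i\<in>I. suffix_sum (c i) w) = suffix_sum (\<lambda>l. \<Sum>i\<in>I. c i l) w"
proof (induction w)
  case (Cons l w)
  have "Poly_Mapping.single x (\<Sum>i\<in>I. c i l) = (\<Sum>i\<in>I. Poly_Mapping.single x (c i l))"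
    for x :: "int ^ 2"
    using \<open>finite I\<close> by (induction I rule: finite_induct) (simp_all add: single_add)
  with Cons show ?case by (simp add: sum.distrib)
qed simp

lemma keys_suffix_sum:
  assumes "signed_word t w"
  shows "Poly_Mapping.keys (suffix_sum c w) = {abel (drop k w) | k. k < length w \<and> c (w ! k) \<noteq> 0}"
  using assms
proof (induction w)
  case (Cons l w)
  let ?K = "\<lambda>w. {abel (drop k w) | k. k < length w \<and> c (w ! k) \<noteq> 0}"
  have w: "signed_word t w" using Cons.prems by (auto simp: signed_word_def)
  \<comment> \<open>Equal classes would have equal heights, hence belong to suffixes of equal
    length, but every later suffix is strictly shorter.\<close>
  have "abel (l # w) \<notin> ?K w"
  proof
    assume "abel (l # w) \<in> ?K w"
    then obtain k where k: "abel (l # w) = abel (drop k w)" "k < length w" by auto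
    have "signed_word t (drop k w)"
      using w set_drop_subset[of k w] by (auto simp: signed_word_def)
    then show False
      using abel_signed_word_height[OF Cons.prems] abel_signed_word_height[of t "drop k w"] k(2)
      unfolding k(1) by simp
  qed
  then have "Poly_Mapping.lookup (suffix_sum c w) (abel (l # w)) = 0"
    unfolding Cons.IH[OF w, symmetric] in_keys_iff by blast
  then have "Poly_Mapping.keys (suffix_sum c (l # w))
      = (if c l \<noteq> 0 then {abel (l # w)} else {}) \<union> Poly_Mapping.keys (suffix_sum c w)"
    by (auto simp: in_keys_iff lookup_add lookup_single when_def split: if_splits)
  also have "\<dots> = ?K (l # w)"
    unfolding Cons.IH[OF w]
  proof (intro equalityI subsetI, goal_cases)
    case (1 x)
    then consider "c l \<noteq> 0" "x = abel (l # w)"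
      | k where "k < length w" "c (w ! k) \<noteq> 0" "x = abel (drop k w)"
      by (auto split: if_splits)
    then show ?case
    proof cases
      case 1
      then have "x = abel (drop 0 (l # w)) \<and> 0 < length (l # w) \<and> c ((l # w) ! 0) \<noteq> 0" by simp
      then show ?thesis by blast
    next
      case (2 k)
      then have "x = abel (drop (Suc k) (l # w)) \<and> Suc k < length (l # w) \<and> c ((l # w) ! Suc k) \<noteq> 0"
        by simp
      then show ?thesis by blast
    qed
  next
    case (2 x)
    then obtain k where "k < length (l # w)" "c ((l # w) ! k) \<noteq> 0" "x = abel (drop k (l # w))"
      by auto
    then show ?case by (cases k) auto
  qed
  finally show ?case .
qed simp

lemma lookup_mult_frag_of: "Poly_Mapping.lookup (p * frag_of v) y = Poly_Mapping.lookup p (y - v)"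
  for v :: "'a::ab_group_add"
  by (induction p rule: frag_induction[OF subset_UNIV])
    (auto simp: frag_of_mult mult_single lookup_minus left_diff_distrib algebra_simps)

text \<open>The starting position that removes the asymmetry of \<open>fox\<close>: for sign 1 the
  shift by e_i adds the missing first letter, for sign -1 that letter is already included.\<close>

definition base_point :: "family \<Rightarrow> 2 \<Rightarrow> int ^ 2" where
  "base_point t i = (if eps t i = 1 then axis i 1 else 0)"

lemma base_point_fox:
  assumes "signed_word t w"
  shows "frag_of (base_point t i) * fox i w
    = suffix_sum (\<lambda>l. if l = signed_letter t i then eps t i else 0) w"
  using assms
proof (induction w)
  case (Cons l w)
  then obtain j where l: "l = signed_letter t j" and w: "signed_word t w"
    by (auto simp: signed_word_def)
  have "frag_of (base_point t i) * fox i (l # w)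
    = Poly_Mapping.single (abel (l # w)) (if i = j then eps t i else 0) + frag_of (base_point t i) * fox i w"
    using eps_cases[of t j]
    by (auto simp: l signed_letter_def base_point_def distrib_left right_diff_distrib frag_of_mult
        algebra_simps single_uminus)
  then show ?case
    using Cons.IH[OF w] inj_signed_letter[of t] by (auto simp: l inj_on_def)
qed simp

text \<open>Covers all fractals at once: \<open>v = 0\<close> gives the plain tiles,
  \<open>I = UNIV\<close> the total fractal, and a suitable \<open>v\<close> the primed
  tiles.\<close>

definition tile_family :: "family \<Rightarrow> 2 set \<Rightarrow> int ^ 2 \<Rightarrow> tiles" where
  "tile_family t I v = (\<Sum>i\<in>I. frag_of (v + base_point t i, i))"

text \<open>The dictionary between tiles and occurrences of letters. A suffix is the whole word
  minus a prefix, so prefixes enter with a minus sign; for an inverse word the class of the whole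
  word drops out.\<close>

lemma keys_tile_subst_funpow_tile_family:
  fixes \<sigma> :: endo
  defines "A \<equiv> (*v) (endo_matrix \<sigma>)" and "B \<equiv> (*v) (matrix_inv (endo_matrix \<sigma>))"
  assumes inv: "\<And>x. B (A x) = x" "\<And>x. A (B x) = x"
    and w: "signed_word t w"
    and word: "(apply_endo \<sigma> ^^ n) [Gen l] = (if pos then w else inv_word w)"
  shows "(z, l) \<in> Poly_Mapping.keys ((tile_subst \<sigma> ^^ n) (tile_family t I v)) \<longleftrightarrow>
    (\<exists>k < length w. w ! k \<in> signed_letter t ` I \<and>
      (A ^^ n) z = v + (if pos then abel w else 0) - abel (take k w))"
proof -
  let ?w = "(apply_endo \<sigma> ^^ n) [Gen l]"
  let ?c = "\<lambda>i l. if l = signed_letter t i then eps t i else 0"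
  let ?p = "suffix_sum (\<lambda>l. \<Sum>i\<in>I. ?c i l) w"
  have I: "finite I" by simp
  \<comment> \<open>Injectivity of \<open>signed_letter\<close> leaves at most one nonzero summand,
    which is 1 or -1.\<close>
  have c: "(\<Sum>i\<in>I. ?c i m) \<noteq> 0 \<longleftrightarrow> m \<in> signed_letter t ` I" for m
  proof (cases "m \<in> range (signed_letter t)")
    case True
    then obtain j where m: "m = signed_letter t j" by auto
    have "(\<Sum>i\<in>I. ?c i m) = (\<Sum>i\<in>I. if i = j then eps t i else 0)"
      using inj_signed_letter[of t] by (intro sum.cong) (auto simp: m inj_on_def)
    then show ?thesis
      using eps_cases[of t j] inj_signed_letter[of t] by (auto simp: m inj_image_mem_iff)
  next
    case False
    then have "(\<Sum>i\<in>I. ?c i m) = 0" by (intro sum.neutral) auto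
    with False show ?thesis by auto
  qed
  have single: "frag_of (v + base_point t i, i) = tile_layer i (frag_of (v + base_point t i))" for i
    by (simp add: tile_layer_def)
  have "Poly_Mapping.lookup ((tile_subst \<sigma> ^^ n) (tile_family t I v)) (z, l)
    = (\<Sum>i\<in>I. Poly_Mapping.lookup (frag_of (v + base_point t i) * fox i ?w) ((A ^^ n) z))"
    unfolding tile_family_def single tile_subst_funpow_sum[OF I] lookup_sum
    using lookup_tile_subst_funpow[of A \<sigma> B] inv unfolding A_def B_def by simp
  also have "\<dots> = Poly_Mapping.lookup (frag_of v * (\<Sum>i\<in>I. frag_of (base_point t i) * fox i ?w)) ((A ^^ n) z)"
    by (simp add: lookup_sum sum_distrib_left frag_of_mult mult.assoc[symmetric])
  finally have lookup: "Poly_Mapping.lookup ((tile_subst \<sigma> ^^ n) (tile_family t I v)) (z, l)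
    = Poly_Mapping.lookup (\<Sum>i\<in>I. frag_of (base_point t i) * fox i ?w) ((A ^^ n) z - v)"
    by (subst (asm) mult.commute) (simp only: lookup_mult_frag_of)
  have suffix: "(\<Sum>i\<in>I. frag_of (base_point t i) * fox i w) = ?p"
    by (simp only: base_point_fox[OF w] suffix_sum_sum[OF I])
  have drop_take: "abel (drop k w) = abel w - abel (take k w)" for k
    using abel_append[of "take k w" "drop k w"] by (simp add: algebra_simps)
  show ?thesis
  proof (cases pos)
    case True
    then show ?thesis
      unfolding in_keys_iff lookup using word
      by (simp only: if_True suffix in_keys_iff[symmetric] keys_suffix_sum[OF w] c drop_take)
        (auto simp: algebra_simps)
  next
    case False
    \<comment> \<open>Inversion negates the sum and translates it by \<open>- abel w\<close>; the
      sign does not affect the support.\<close>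
    have "(\<Sum>i\<in>I. frag_of (base_point t i) * fox i (inv_word w)) = - (?p * frag_of (- abel w))"
      by (simp add: fox_inv_word suffix[symmetric] sum_negf sum_distrib_right mult.assoc)
    then have "Poly_Mapping.lookup (\<Sum>i\<in>I. frag_of (base_point t i) * fox i ?w) ((A ^^ n) z - v)
      = - Poly_Mapping.lookup ?p ((A ^^ n) z - v + abel w)"
      using False word by (simp add: lookup_mult_frag_of)
    then show ?thesis
      unfolding in_keys_iff lookup using False
      by (simp only: neg_equal_0_iff_equal in_keys_iff[symmetric] keys_suffix_sum[OF w] c drop_take)
        (auto simp: algebra_simps)
  qed
qed


section \<open>The projection along the expanding line\<close>

lemma embed_0 [simp]: "embed 0 = 0"
  and embed_add: "embed (x + y) = embed x + embed y"
  and embed_diff: "embed (x - y) = embed x - embed y"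
  by (simp_all add: embed_def vec_eq_iff)

lemma real_matrix_mult_embed: "real_matrix \<sigma> *v embed x = embed (endo_matrix \<sigma> *v x)"
  by (simp add: vec_eq_iff real_matrix_def embed_def matrix_vector_mult_def)

lemma abel_replicate: "abel (replicate m l) = int m *s abel_letter l"
  by (induction m) (simp_all add: vec_eq_iff algebra_simps)

lemma abel_gen_power: "abel (gen_power i k) = k *s axis i 1"
  by (simp add: gen_power_def abel_replicate vec_eq_iff)

locale automorphism_family =
  fixes t :: family and a :: int
  assumes admissible: "admissible t a"
begin

abbreviation \<sigma> :: endo where "\<sigma> \<equiv> sigma t a"

text \<open>The determinant of the matrix, whose characteristic polynomial is x^2 - a x + d.\<close>

definition d :: int where "d = (if t = F4 then - 1 else 1)"

abbreviation A :: "int ^ 2 \<Rightarrow> int ^ 2" where "A \<equiv> (*v) (endo_matrix \<sigma>)"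

lemma d_mult_d: "d * d = 1"
  by (simp add: d_def)

lemma endo_matrix_sigma:
  "endo_matrix \<sigma> $ 1 $ 1 = 0" "endo_matrix \<sigma> $ 1 $ 2 = - d"
  "endo_matrix \<sigma> $ 2 $ 1 = 1" "endo_matrix \<sigma> $ 2 $ 2 = a"
proof -
  have "\<sigma> 1 = [Gen 2]" by (cases t) simp_all
  moreover have "abel (\<sigma> 2) = - d *s axis 1 1 + a *s axis 2 1"
  proof (cases t)
    case F1
    moreover have "d = 1" unfolding d_def using F1 by simp
    ultimately show ?thesis by (simp add: abel_gen_power vec_eq_iff axis_def)
  next
    case F2
    moreover have "d = 1" unfolding d_def using F2 by simp
    ultimately show ?thesis by (simp add: abel_gen_power vec_eq_iff)
  next
    case F4
    moreover have "d = - 1" unfolding d_def using F4 by simp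
    ultimately show ?thesis by (simp add: abel_gen_power vec_eq_iff)
  qed
  ultimately show "endo_matrix \<sigma> $ 1 $ 1 = 0" "endo_matrix \<sigma> $ 1 $ 2 = - d"
      "endo_matrix \<sigma> $ 2 $ 1 = 1" "endo_matrix \<sigma> $ 2 $ 2 = a"
    by (simp_all add: endo_matrix_def axis_def)
qed

lemma matrix_inv_sigma:
  "matrix_inv (endo_matrix \<sigma>) *v (A x) = x"
  "A (matrix_inv (endo_matrix \<sigma>) *v x) = x"
proof -
  \<comment> \<open>The adjugate multiplied by \<open>d\<close>, which is its own inverse.\<close>
  let ?B = "\<chi> i j. if i = 1 then (if j = 1 then a * d else 1) else (if j = 1 then - d else 0)"
  have "a * (d * d) = a"
    by (simp only: d_mult_d mult_1_right)
  then have "endo_matrix \<sigma> ** ?B = mat 1 \<and> ?B ** endo_matrix \<sigma> = mat 1"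
    using d_mult_d
    by (auto simp: vec_eq_iff forall_2 matrix_matrix_mult_def sum_2 endo_matrix_sigma mat_def ac_simps)
  then have inv: "endo_matrix \<sigma> ** matrix_inv (endo_matrix \<sigma>) = mat 1
      \<and> matrix_inv (endo_matrix \<sigma>) ** endo_matrix \<sigma> = mat 1"
    unfolding matrix_inv_def by (rule someI)
  then show "matrix_inv (endo_matrix \<sigma>) *v (A x) = x" "A (matrix_inv (endo_matrix \<sigma>) *v x) = x"
    by (simp_all add: matrix_vector_mul_assoc matrix_vector_mul_lid)
qed

text \<open>The polynomial changes sign on [-1,0] for \<open>F2\<close> and on [0,1] otherwise, and
  vanishes at neither end point.\<close>

lemma contracting_root: "\<exists>c::real. \<bar>c\<bar> < 1 \<and> c \<noteq> 0 \<and> c\<^sup>2 - a * c + d = 0"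
proof -
  let ?q = "\<lambda>c::real. c\<^sup>2 - a * c + d"
  have cont: "continuous_on S ?q" for S by (intro continuous_intros)
  have a: "admissible t a" by (rule admissible)
  consider "t = F1" | "t = F2" | "t = F4" by (cases t)
  then show ?thesis
  proof cases
    case 1
    moreover have "d = 1" unfolding d_def using 1 by simp
    ultimately have "?q 1 \<le> 0" "?q 0 \<ge> 0" "?q 1 \<noteq> 0" "?q 0 \<noteq> 0" using a by simp_all
    moreover from this obtain c where "0 \<le> c" "c \<le> 1" "?q c = 0"
      using IVT2'[of ?q 1 0 0, OF _ _ _ cont] by auto
    ultimately show ?thesis by (intro exI[of _ c]) (auto simp: abs_if less_le)
  next
    case 2
    moreover have "d = 1" unfolding d_def using 2 by simp
    ultimately have "?q (- 1) \<le> 0" "?q 0 \<ge> 0" "?q (- 1) \<noteq> 0" "?q 0 \<noteq> 0" using a by simp_all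
    moreover from this obtain c where "- 1 \<le> c" "c \<le> 0" "?q c = 0"
      using IVT'[of ?q "- 1" 0 0, OF _ _ _ cont] by auto
    ultimately show ?thesis by (intro exI[of _ c]) (auto simp: abs_if less_le)
  next
    case 3
    moreover have "d = - 1" unfolding d_def using 3 by simp
    ultimately have "?q 0 \<le> 0" "?q 1 \<ge> 0" "?q 1 \<noteq> 0" "?q 0 \<noteq> 0" using a by simp_all
    moreover from this obtain c where "0 \<le> c" "c \<le> 1" "?q c = 0"
      using IVT'[of ?q 0 0 1, OF _ _ _ cont] by auto
    ultimately show ?thesis by (intro exI[of _ c]) (auto simp: abs_if less_le)
  qed
qed

definition \<mu> :: real where
  "\<mu> = (SOME c::real. \<bar>c\<bar> < 1 \<and> c \<noteq> 0 \<and> c\<^sup>2 - a * c + d = 0)"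

text \<open>The other root by Vieta, as the trace is \<open>a\<close>.\<close>

definition \<kappa> :: real where "\<kappa> = a - \<mu>"

lemma abs_mu: "\<bar>\<mu>\<bar> < 1" and mu_nonzero: "\<mu> \<noteq> 0" and mu_root: "\<mu>\<^sup>2 - a * \<mu> + d = 0"
  using someI_ex[OF contracting_root] unfolding \<mu>_def by blast+

lemma kappa_mu: "\<kappa> * \<mu> = d"
  using mu_root by (simp add: \<kappa>_def algebra_simps power2_eq_square)

lemma abs_kappa: "\<bar>\<kappa>\<bar> > 1"
proof -
  have "\<bar>\<kappa>\<bar> * \<bar>\<mu>\<bar> = 1"
    using kappa_mu by (simp add: abs_mult[symmetric] d_def)
  then show ?thesis
    using abs_mu by (smt (verit) mult_le_one abs_ge_zero mult_left_le_one_le)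
qed

section \<open>Eigenlines and an explicit formula for the projection\<close>

abbreviation M :: "real ^ 2 ^ 2" where "M \<equiv> real_matrix \<sigma>"

lemma M_mult: "(M *v v) $ 1 = - real_of_int d * v $ 2" "(M *v v) $ 2 = v $ 1 + a * v $ 2"
  by (simp_all add: matrix_vector_mult_def sum_2 real_matrix_def endo_matrix_sigma)

lemma eigenvector_iff: "M *v v = c *\<^sub>R v \<longleftrightarrow> - d * v $ 2 = c * v $ 1 \<and> v $ 1 + a * v $ 2 = c * v $ 2"
  by (simp add: vec_eq_iff forall_2 M_mult)

lemma is_eigenvalue_iff: "is_eigenvalue M c \<longleftrightarrow> c = \<kappa> \<or> c = \<mu>"
proof -
  have factor: "c\<^sup>2 - a * c + d = (c - \<kappa>) * (c - \<mu>)"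
    using kappa_mu by (simp add: \<kappa>_def algebra_simps power2_eq_square)
  have "c\<^sup>2 - a * c + d = 0" if v: "v \<noteq> 0" "M *v v = c *\<^sub>R v" for v
  proof -
    have e: "- d * v $ 2 = c * v $ 1" "v $ 1 = (c - a) * v $ 2"
      using v(2) by (auto simp: eigenvector_iff algebra_simps)
    have "v $ 2 \<noteq> 0"
      using v(1) e(2) by (auto simp: vec_eq_iff forall_2)
    moreover have "(c\<^sup>2 - a * c + d) * v $ 2 = 0"
      using e by (simp add: algebra_simps power2_eq_square)
    ultimately show ?thesis by simp
  qed
  moreover have "is_eigenvalue M c" if "c\<^sup>2 - a * c + d = 0"
    unfolding is_eigenvalue_def
  proof (intro exI conjI)
    \<comment> \<open>The second row of the eigenvector equation forces this shape; the first row is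
      then the characteristic equation.\<close>
    let ?v = "vector [c - a, 1] :: real ^ 2"
    show "?v \<noteq> 0" by (simp add: vec_eq_iff forall_2)
    show "M *v ?v = c *\<^sub>R ?v"
      using that by (simp add: eigenvector_iff algebra_simps power2_eq_square)
  qed
  ultimately show ?thesis
    unfolding is_eigenvalue_def factor by auto
qed

lemma contracting_line: "contracting_line \<sigma> = {v. M *v v = \<mu> *\<^sub>R v}"
proof -
  have "(THE c. is_eigenvalue M c \<and> \<bar>c\<bar> < 1) = \<mu>"
    using abs_mu abs_kappa by (intro the_equality) (auto simp: is_eigenvalue_iff)
  then show ?thesis by (simp add: contracting_line_def eigenspace_def)
qed

lemma expanding_line: "expanding_line \<sigma> = {v. M *v v = \<kappa> *\<^sub>R v}"
proof -
  have "(THE c. is_eigenvalue M c \<and> \<bar>c\<bar> > 1) = \<kappa>"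
    using abs_mu abs_kappa by (intro the_equality) (auto simp: is_eigenvalue_iff)
  then show ?thesis by (simp add: expanding_line_def eigenspace_def)
qed

lemma contracting_vector: "M *v vector [- real_of_int d, \<mu>] = \<mu> *\<^sub>R vector [- real_of_int d, \<mu>]"
  using mu_root by (simp add: eigenvector_iff algebra_simps power2_eq_square)

lemma expanding_vector: "w $ 1 = - \<mu> * w $ 2 \<Longrightarrow> M *v w = \<kappa> *\<^sub>R w"
  using kappa_mu by (simp add: eigenvector_iff mult.assoc[symmetric]) (simp add: \<kappa>_def algebra_simps)

text \<open>The functional v_1 + \<mu> v_2 vanishes on the expanding line, the vector spans the
  contracting line, and the denominator is the value of the functional on that vector.\<close>

lemma proj_eq:
  "proj \<sigma> v = ((v $ 1 + \<mu> * v $ 2) / (\<mu>\<^sup>2 - d)) *\<^sub>R vector [- real_of_int d, \<mu>]"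
  (is "_ = ?p")
proof -
  have "\<mu>\<^sup>2 - d = (\<mu> - \<kappa>) * \<mu>"
    using kappa_mu by (simp add: power2_eq_square algebra_simps)
  then have nz: "\<mu>\<^sup>2 - d \<noteq> 0"
    using mu_nonzero abs_mu abs_kappa by auto
  have p: "M *v ?p = \<mu> *\<^sub>R ?p"
    by (simp add: matrix_vector_mult_scaleR contracting_vector)
  have "(v - ?p) $ 1 = - \<mu> * (v - ?p) $ 2"
    using nz by (simp add: field_simps power2_eq_square)
  then have q: "M *v (v - ?p) = \<kappa> *\<^sub>R (v - ?p)"
    by (rule expanding_vector)
  show ?thesis
    unfolding proj_def contracting_line expanding_line
  proof (rule the_equality)
    show "?p \<in> {v. M *v v = \<mu> *\<^sub>R v} \<and> v - ?p \<in> {v. M *v v = \<kappa> *\<^sub>R v}"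
      using p q by simp
  next
    fix r assume r: "r \<in> {v. M *v v = \<mu> *\<^sub>R v} \<and> v - r \<in> {v. M *v v = \<kappa> *\<^sub>R v}"
    \<comment> \<open>Two candidates differ by a vector lying in both eigenlines, hence by zero
      since \<mu> and \<kappa> differ.\<close>
    have "M *v (r - ?p) = \<mu> *\<^sub>R (r - ?p)"
      using r p by (simp add: matrix_vector_mult_diff_distrib scaleR_diff_right)
    moreover have "M *v (r - ?p) = M *v (v - ?p) - M *v (v - r)"
      by (simp add: matrix_vector_mult_diff_distrib)
    ultimately have "\<mu> *\<^sub>R (r - ?p) = \<kappa> *\<^sub>R (r - ?p)"
      using r q by (simp add: scaleR_diff_right)
    then show "r = ?p"
      using abs_mu abs_kappa by auto
  qed
qed

lemma linear_proj: "linear (proj \<sigma>)"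
  by (rule linearI) (simp_all add: proj_eq algebra_simps add_divide_distrib scaleR_add_left)

lemma M_proj: "M *v proj \<sigma> v = \<mu> *\<^sub>R proj \<sigma> v"
  by (simp add: proj_eq matrix_vector_mult_scaleR contracting_vector)

lemma proj_M: "proj \<sigma> (M *v v) = \<mu> *\<^sub>R proj \<sigma> v"
proof -
  have "(M *v v) $ 1 + \<mu> * (M *v v) $ 2 = \<mu> * (v $ 1 + \<mu> * v $ 2)"
    unfolding M_mult using mu_root by algebra
  then show ?thesis by (simp add: proj_eq)
qed

definition \<pi> :: "int ^ 2 \<Rightarrow> real ^ 2" where "\<pi> x = proj \<sigma> (embed x)"

lemma pi_0 [simp]: "\<pi> 0 = 0"
  and pi_add: "\<pi> (x + y) = \<pi> x + \<pi> y"
  and pi_diff: "\<pi> (x - y) = \<pi> x - \<pi> y"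
  and pi_A: "\<pi> (A x) = \<mu> *\<^sub>R \<pi> x"
  using linear_proj proj_M[of "embed x"]
  by (simp_all add: \<pi>_def linear_0 linear_add linear_diff embed_add embed_diff real_matrix_mult_embed)

lemma pi_minus: "\<pi> (- x) = - \<pi> x"
  using pi_diff[of 0 x] by simp

lemma pi_funpow_A: "\<pi> ((A ^^ n) x) = \<mu> ^ n *\<^sub>R \<pi> x"
  by (induction n) (simp_all add: pi_A)

lemma mu_power_tendsto: "(\<lambda>n. \<bar>\<mu>\<bar> ^ n) \<longlonglongrightarrow> 0"
  using abs_mu by (intro LIMSEQ_power_zero) simp

lemma funpow_M_proj: "((*v) M ^^ n) (proj \<sigma> v) = \<mu> ^ n *\<^sub>R proj \<sigma> v"
  by (induction n) (simp_all add: matrix_vector_mult_scaleR M_proj)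

text \<open>Renormalization turns the tile at z into the point \<pi>(A^n z) plus a segment shrunk by
  \<mu>^n; the error estimates start from this form.\<close>

lemma mem_approximation_iff:
  "x \<in> ((*v) M ^^ n) ` proj \<sigma> ` realize g \<longleftrightarrow>
    (\<exists>z l s. (z, l) \<in> Poly_Mapping.keys g \<and> 0 \<le> s \<and> s \<le> 1 \<and>
      x = \<pi> ((A ^^ n) z) + (s * \<mu> ^ n) *\<^sub>R proj \<sigma> (axis (if l = 1 then 2 else 1) 1))"
proof -
  have "((*v) M ^^ n) (proj \<sigma> (embed z + s *\<^sub>R v)) = \<pi> ((A ^^ n) z) + (s * \<mu> ^ n) *\<^sub>R proj \<sigma> v" for z s v
    unfolding funpow_M_proj pi_funpow_A
    by (simp add: \<pi>_def linear_add[OF linear_proj] linear_scale[OF linear_proj] scaleR_add_right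
        mult.commute)
  note shrink = this
  show ?thesis
  proof
    assume "x \<in> ((*v) M ^^ n) ` proj \<sigma> ` realize g"
    then obtain z l y where "(z, l) \<in> Poly_Mapping.keys g" "y \<in> segment (z, l)"
        "x = ((*v) M ^^ n) (proj \<sigma> y)"
      unfolding realize_def by auto
    moreover from this obtain s where "0 \<le> s" "s \<le> 1" "y = embed z + s *\<^sub>R axis (if l = 1 then 2 else 1) 1"
      unfolding segment_def by auto
    ultimately show "\<exists>z l s. (z, l) \<in> Poly_Mapping.keys g \<and> 0 \<le> s \<and> s \<le> 1 \<and>
        x = \<pi> ((A ^^ n) z) + (s * \<mu> ^ n) *\<^sub>R proj \<sigma> (axis (if l = 1 then 2 else 1) 1)"
      unfolding shrink[symmetric] by blast
  next
    assume "\<exists>z l s. (z, l) \<in> Poly_Mapping.keys g \<and> 0 \<le> s \<and> s \<le> 1 \<and>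
        x = \<pi> ((A ^^ n) z) + (s * \<mu> ^ n) *\<^sub>R proj \<sigma> (axis (if l = 1 then 2 else 1) 1)"
    then obtain z l s where zl: "(z, l) \<in> Poly_Mapping.keys g" and s: "0 \<le> s" "s \<le> 1"
      and x: "x = ((*v) M ^^ n) (proj \<sigma> (embed z + s *\<^sub>R axis (if l = 1 then 2 else 1) 1))"
      unfolding shrink[symmetric] by blast
    have "embed z + s *\<^sub>R axis (if l = 1 then 2 else 1) 1 \<in> segment (z, l)"
      using s unfolding segment_def by blast
    then show "x \<in> ((*v) M ^^ n) ` proj \<sigma> ` realize g"
      using zl unfolding x realize_def by blast
  qed
qed

end


section \<open>The words generating the one-sided sequences\<close>

lemma prefix_concat_map:
  "prefix xs ys \<Longrightarrow> prefix (concat (map f xs)) (concat (map f ys))"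
  by (auto simp: prefix_def)

lemma suffix_concat_map:
  "suffix xs ys \<Longrightarrow> suffix (concat (map f xs)) (concat (map f ys))"
  by (auto simp: suffix_def)

lemma prefix_concat_mapE:
  assumes "prefix q (concat (map f p))"
  obtains p' j q' where "prefix p' p" "prefix q' (f j)" "q = concat (map f p') @ q'"
proof -
  have "\<exists>p' j q'. prefix p' p \<and> prefix q' (f j) \<and> q = concat (map f p') @ q'"
    using assms
  proof (induction p arbitrary: q)
    case (Cons x p)
    then consider "prefix q (f x)" | u where "q = f x @ u" "prefix u (concat (map f p))"
      by (auto simp: prefix_append)
    then show ?case
    proof cases
      case 1
      then show ?thesis by (intro exI[of _ "[]"] exI[of _ x] exI[of _ q]) simp
    next
      case (2 u)
      from Cons.IH[OF 2(2)] obtain p' j q'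
        where "prefix p' p" "prefix q' (f j)" "u = concat (map f p') @ q'" by blast
      then show ?thesis
        using 2(1) by (intro exI[of _ "x # p'"] exI[of _ j] exI[of _ q']) simp
    qed
  qed simp
  then show thesis using that by blast
qed

lemma prefixes_bounded:
  fixes f :: "'b::finite \<Rightarrow> 'c list" and g :: "'c list \<Rightarrow> real"
  obtains C where "\<And>j q. prefix q (f j) \<Longrightarrow> g q \<le> C"
proof -
  have "finite (\<Union>j. {q. prefix q (f j)})"
    by (simp add: set_prefixes_eq[symmetric])
  then have "bdd_above (g ` (\<Union>j. {q. prefix q (f j)}))"
    by (intro bdd_above_finite) simp
  then obtain C where C: "\<And>x. x \<in> g ` (\<Union>j. {q. prefix q (f j)}) \<Longrightarrow> x \<le> C"
    unfolding bdd_above_def by blast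
  have "g q \<le> C" if "prefix q (f j)" for j q
    using that by (intro C) blast
  then show thesis using that by blast
qed

lemma length_concat_map_ge:
  assumes "\<And>x. f x \<noteq> []"
  shows "length xs \<le> length (concat (map f xs))"
proof (induction xs)
  case (Cons x xs)
  have "1 \<le> length (f x)" using assms[of x] by (cases "f x") auto
  with Cons show ?case by simp
qed simp

lemma length_concat_map_gt:
  assumes "\<And>x. f x \<noteq> []" "y \<in> set xs" "2 \<le> length (f y)"
  shows "length xs < length (concat (map f xs))"
proof -
  obtain us vs where "xs = us @ y # vs" using assms(2) by (meson split_list)
  then show ?thesis
    using length_concat_map_ge[of f us, OF assms(1)] length_concat_map_ge[of f vs, OF assms(1)] assms(3)
    by simp
qed

lemma prefix_replicate: "0 < m \<Longrightarrow> prefix [x] (replicate m x)"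
  by (cases m) simp_all

lemma nth_prefix: "prefix u v \<Longrightarrow> k < length u \<Longrightarrow> v ! k = u ! k"
  by (auto simp: prefix_def nth_append)

section \<open>Limits of nested prefixes\<close>

context
  fixes V :: "nat \<Rightarrow> word"
  assumes chain: "\<And>n. prefix (V n) (V (Suc n))" and length: "\<And>n. n < length (V n)"
begin

lemma chain_nth:
  assumes "k < length (V n)"
  shows "V n ! k = V k ! k"
proof -
  have mono: "prefix (V m) (V n)" if "m \<le> n" for m n
    using that by (induction rule: dec_induct) (auto intro: prefix_order.trans chain)
  show ?thesis
  proof (cases "k \<le> n")
    case True
    then show ?thesis using nth_prefix[OF mono[OF True] length] by simp
  next
    case False
    then show ?thesis using nth_prefix[OF mono[of n k] assms] by simp
  qed
qed

text \<open>In a product of discrete spaces convergence means that each coordinate is eventually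
  constant; along the chain letter \<open>k\<close> is fixed from index \<open>k\<close> on, where
  \<open>padded\<close> no longer shows a blank.\<close>

lemma word_limit_chain: "word_limit V = (\<lambda>k. V k ! k)"
proof -
  have lim: "limitin (product_topology (\<lambda>_. discrete_topology UNIV) UNIV)
      (\<lambda>n. padded (V n)) (\<lambda>k. Some (s k)) sequentially
    \<longleftrightarrow> (\<forall>k. \<forall>\<^sub>F n in sequentially. padded (V n) k = Some (s k))" for s
  proof -
    have "limitin (discrete_topology UNIV) f l sequentially \<longleftrightarrow> (\<forall>\<^sub>F n in sequentially. f n = l)"
      for f and l :: "letter option"
      by (force simp: limitin_def elim: eventually_mono dest: spec[of _ "{l}"])
    then show ?thesis
      by (simp add: limitin_componentwise)
  qed
  have ev: "\<forall>\<^sub>F n in sequentially. padded (V n) k = Some (V k ! k)" for k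
    using eventually_ge_at_top[of k]
  proof eventually_elim
    case (elim n)
    then have "k < length (V n)" using length[of n] by simp
    then show ?case by (simp add: padded_def chain_nth)
  qed
  show ?thesis
    unfolding word_limit_def lim
  proof (rule the_equality)
    show "\<forall>k. \<forall>\<^sub>F n in sequentially. padded (V n) k = Some (V k ! k)"
      using ev by simp
  next
    fix s assume s: "\<forall>k. \<forall>\<^sub>F n in sequentially. padded (V n) k = Some (s k)"
    have "s k = V k ! k" for k
    proof -
      have "\<forall>\<^sub>F n in sequentially. Some (s k) = Some (V k ! k)"
        using spec[OF s, of k] ev[of k] by eventually_elim simp
      then show ?thesis by simp
    qed
    then show "s = (\<lambda>k. V k ! k)" by auto
  qed
qed

end

lemma signed_word_append: "signed_word t (u @ v) \<longleftrightarrow> signed_word t u \<and> signed_word t v"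
  by (auto simp: signed_word_def)

lemma signed_word_reduced:
  assumes "signed_word t w"
  shows "reduced w"
  using assms
proof (induction w)
  case (Cons l w)
  have "signed_letter t i \<noteq> inv_letter (signed_letter t j)" for i j
    by (auto simp: signed_letter_def eps_def)
  with Cons show ?case
    by (cases w) (auto simp: reduced_Cons signed_word_def)
qed (simp add: reduced_def)

text \<open>
  \<open>unfold_block\<close> is the map \<open>\<delta>\<^sup>-\<^sup>1\<close> on positive words and \<open>subst\<close> is \<open>\<tau>\<close>, where for the families
  \<open>F2\<close> and \<open>F4\<close> the images under \<open>\<tau>\<close> are negative words and are replaced by their inverses. Inversion
  reverses the order of the letters, hence \<open>mirror\<close>.
\<close>

definition block :: "family \<Rightarrow> 2 \<Rightarrow> word" where
  "block t j = (if j = 2 then [Gen 2] else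
     case t of F1 \<Rightarrow> [Inv 1, Gen 2] | F2 \<Rightarrow> [Gen 2, Gen 1] | F4 \<Rightarrow> [Inv 1])"

definition unfold_block :: "family \<Rightarrow> 2 list \<Rightarrow> word" where
  "unfold_block t p = concat (map (block t) p)"

definition subst_letter :: "family \<Rightarrow> int \<Rightarrow> 2 \<Rightarrow> 2 list" where
  "subst_letter t a j = (case t of
     F1 \<Rightarrow> replicate (nat (if j = 1 then a - 3 else a - 2)) 2 @ [1, 2]
   | F2 \<Rightarrow> replicate (nat (if j = 1 then - a - 2 else - a - 1)) 2 @ [1]
   | F4 \<Rightarrow> (if j = 1 then [2] else replicate (nat (- a)) 2 @ [1]))"

definition subst :: "family \<Rightarrow> int \<Rightarrow> 2 list \<Rightarrow> 2 list" where
  "subst t a p = concat (map (subst_letter t a) p)"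

definition mirror :: "family \<Rightarrow> 2 list \<Rightarrow> 2 list" where
  "mirror t p = (if t = F1 then p else rev p)"

primrec seed :: "family \<Rightarrow> int \<Rightarrow> nat \<Rightarrow> 2 list" where
  "seed t a 0 = [2]"
| "seed t a (Suc n) = subst t a (mirror t (seed t a n))"

definition W :: "family \<Rightarrow> int \<Rightarrow> nat \<Rightarrow> word" where
  "W t a n = unfold_block t (seed t a n)"

text \<open>The sign of the n-th image of the letter 2: for \<open>F2\<close> and \<open>F4\<close>
  the map \<tau> sends positive words to negative ones, so each step flips it.\<close>

definition pos :: "family \<Rightarrow> nat \<Rightarrow> bool" where "pos t n \<longleftrightarrow> t = F1 \<or> even n"

lemma unfold_block_simps [simp]:
  "unfold_block t [] = []" "unfold_block t (j # p) = block t j @ unfold_block t p"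
  "unfold_block t (p @ q) = unfold_block t p @ unfold_block t q"
  by (simp_all add: unfold_block_def)

lemma subst_simps [simp]:
  "subst t a [] = []" "subst t a (j # p) = subst_letter t a j @ subst t a p"
  "subst t a (p @ q) = subst t a p @ subst t a q"
  by (simp_all add: subst_def)

lemma signed_word_block: "signed_word t (block t j)"
proof -
  have "set (block t j) \<subseteq> {signed_letter t 1, signed_letter t 2}"
    by (cases t) (auto simp: block_def signed_letter_def eps_def)
  then show ?thesis by (auto simp: signed_word_def)
qed

lemma signed_word_unfold_block: "signed_word t (unfold_block t p)"
proof (induction p)
  case Nil
  show ?case by (simp add: signed_word_def)
next
  case (Cons j p)
  then show ?case by (simp add: signed_word_append signed_word_block)
qed

lemma set_mirror [simp]: "set (mirror t p) = set p"
  and length_mirror [simp]: "length (mirror t p) = length p"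
  and mirror_singleton [simp]: "mirror t [x] = [x]"
  and mirror_mirror [simp]: "mirror t (mirror t p) = p"
  by (simp_all add: mirror_def)

lemma suffix_subst_mirror:
  "t \<noteq> F1 \<Longrightarrow> prefix p q \<Longrightarrow> suffix (subst t a (mirror t p)) (subst t a (mirror t q))"
  unfolding subst_def by (rule suffix_concat_map) (simp add: mirror_def suffix_to_prefix)

lemma prefix_subst_mirror:
  "t \<noteq> F1 \<Longrightarrow> suffix p q \<Longrightarrow> prefix (subst t a (mirror t p)) (subst t a (mirror t q))"
  unfolding subst_def by (rule prefix_concat_map) (simp add: mirror_def suffix_to_prefix)

lemma signed_word_W: "signed_word t (W t a n)"
  by (simp add: W_def signed_word_unfold_block)

lemma reduce_unfold_block: "reduce (unfold_block t p) = unfold_block t p"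
  by (rule reduce_reduced signed_word_reduced signed_word_unfold_block)+

lemma signed_letter_in_block: "signed_letter t j \<in> set (block t j)"
  using exhaust_2[of j] by (cases t) (auto simp: block_def signed_letter_def eps_def)

lemma unfold_block_replicate: "unfold_block t (replicate m 2) = replicate m (Gen 2)"
  by (induction m) (simp_all add: block_def)

lemma inv_word_replicate: "inv_word (replicate m l) = replicate m (inv_letter l)"
  by (simp add: inv_word_def)

section \<open>Conjugation to a substitution on positive words\<close>

context automorphism_family
begin

text \<open>The relation \<sigma> \<delta>^-1 = \<delta>^-1 \<tau> on letters. The right side is a
  signed word or the inverse of one, hence reduced, so only cancellations on the left need
  work.\<close>

lemma reduce_image_block:
  "reduce (concat (map (letter_image \<sigma>) (block t j)))
    = (if t = F1 then unfold_block t (subst_letter t a j) else inv_word (unfold_block t (subst_letter t a j)))"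
proof -
  have adm: "admissible t a" by (rule admissible)
  have inv: "reduce (inv_word (unfold_block t p)) = inv_word (unfold_block t p)" for p
    by (simp add: reduce_inv_word reduce_unfold_block)
  consider "t = F1" | "t = F2" | "t = F4" by (cases t)
  then show ?thesis
  proof cases
    case 1
    then have "a \<ge> 3" using adm by simp
    then obtain m where m: "a = int m + 3" by (intro that[of "nat (a - 3)"]) simp
    have u: "unfold_block t (replicate k 2 @ [1, 2]) = replicate k (Gen 2) @ [Inv 1, Gen 2, Gen 2]" for k
      using 1 by (simp add: unfold_block_replicate block_def)
    have g: "gen_power 2 (a - 2) = replicate (Suc m) (Gen 2)"
      by (simp add: gen_power_def m nat_add_distrib)
    have s: "subst_letter t a j = replicate (if j = 1 then m else Suc m) 2 @ [1, 2]"
      using 1 by (simp add: subst_letter_def m nat_add_distrib)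
    show ?thesis
    proof (cases "j = 1")
      case True
      \<comment> \<open>The image of \<open>Inv 1\<close> is \<open>Inv 2\<close>, which cancels the
        first letter of the image of \<open>Gen 2\<close>.\<close>
      let ?z = "replicate m (Gen 2) @ [Inv 1, Gen 2, Gen 2]"
      have "concat (map (letter_image \<sigma>) (block t j)) = [Inv 2, Gen 2] @ ?z"
        using 1 True g by (simp add: block_def inv_word_def)
      moreover have "reduce ([Inv 2, Gen 2] @ ?z) = reduce ?z"
        using push_inv_letter_push[OF reduced_reduce[of ?z], of "Inv 2"] by (simp add: reduce_def)
      moreover have "unfold_block t (subst_letter t a j) = ?z" and "reduce ?z = ?z"
        using True reduce_unfold_block[of t "replicate m 2 @ [1, 2]"] unfolding s u by simp_all
      ultimately show ?thesis
        by (simp only: if_P[OF 1])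
    next
      case False
      then have "concat (map (letter_image \<sigma>) (block t j)) = unfold_block t (subst_letter t a j)"
        unfolding s u using 1 g exhaust_2[of j] by (simp add: block_def s u)
      then show ?thesis using 1 by (simp add: reduce_unfold_block)
    qed
  next
    case 2
    then have "a \<le> - 3" using adm by simp
    then obtain m where m: "a = - int m - 2" by (intro that[of "nat (- a - 2)"]) simp
    have g: "gen_power 2 a = replicate (Suc (Suc m)) (Inv 2)"
      by (simp add: gen_power_def m nat_add_distrib)
    have s: "subst_letter t a j = replicate (if j = 1 then m else Suc m) 2 @ [1]"
      using 2 by (simp add: subst_letter_def m nat_add_distrib)
    have u: "inv_word (unfold_block t (replicate k 2 @ [1])) = Inv 1 # replicate (Suc k) (Inv 2)" for k
      using 2 by (simp add: unfold_block_replicate block_def inv_word_append inv_word_replicate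
          inv_word_def)
    show ?thesis
    proof (cases "j = 1")
      case True
      \<comment> \<open>Here the cancelling pair stands at the end, where the image of
        \<open>Gen 2\<close> meets that of \<open>Gen 1\<close>.\<close>
      let ?u = "Inv 1 # replicate (Suc m) (Inv 2)"
      have "concat (map (letter_image \<sigma>) (block t j)) = ?u @ [Inv 2, Gen 2]"
        using 2 True g by (simp add: block_def replicate_append_same)
      moreover have "reduce (?u @ [Inv 2, Gen 2]) = reduce ?u"
        using reduce_append[of ?u "[Inv 2, Gen 2]"] reduce_reduced[OF reduced_reduce[of ?u]]
        by (simp add: reduce_def[of "[Inv 2, Gen 2]"])
      ultimately show ?thesis
        using 2 True inv[of "replicate m 2 @ [1]"] unfolding s u by simp
    next
      case False
      then have "concat (map (letter_image \<sigma>) (block t j)) = inv_word (unfold_block t (subst_letter t a j))"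
        unfolding s u using 2 g exhaust_2[of j] by (simp add: block_def s u)
      then have "reduce (concat (map (letter_image \<sigma>) (block t j)))
          = inv_word (unfold_block t (subst_letter t a j))"
        by (simp only: inv)
      with 2 show ?thesis by simp
    qed
  next
    case 3
    then have "a \<le> - 1" using adm by simp
    then have g: "gen_power 2 a = replicate (nat (- a)) (Inv 2)"
      by (simp add: gen_power_def)
    have u: "inv_word (unfold_block t (replicate k 2 @ [1])) = Gen 1 # replicate k (Inv 2)" for k
      using 3 by (simp add: unfold_block_replicate block_def inv_word_append inv_word_replicate
          inv_word_def)
    have "concat (map (letter_image \<sigma>) (block t j)) = inv_word (unfold_block t (subst_letter t a j))"
    proof (cases "j = 1")
      case True
      then show ?thesis using 3 by (simp add: block_def subst_letter_def inv_word_def)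
    next
      case False
      then have s: "subst_letter t a j = replicate (nat (- a)) 2 @ [1]"
        using 3 by (simp add: subst_letter_def)
      show ?thesis
        unfolding s u using 3 False g exhaust_2[of j] by (simp add: block_def)
    qed
    then have "reduce (concat (map (letter_image \<sigma>) (block t j)))
        = inv_word (unfold_block t (subst_letter t a j))"
      by (simp only: inv)
    with 3 show ?thesis by simp
  qed
qed

lemma concat_map_unfold_block:
  "concat (map f (unfold_block t p)) = concat (map (\<lambda>j. concat (map f (block t j))) p)"
  by (induction p) simp_all

lemma concat_map_inv_word: "concat (map (\<lambda>j. inv_word (f j)) p) = inv_word (concat (map f (rev p)))"
  by (induction p) (simp_all add: inv_word_append)

lemma unfold_block_subst: "unfold_block t (subst t a p) = concat (map (\<lambda>j. unfold_block t (subst_letter t a j)) p)"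
  by (induction p) simp_all

text \<open>For \<open>F2\<close> and \<open>F4\<close> every block goes to an inverse word, and a
  product of inverses is the inverse of the product in reversed order; \<open>mirror\<close>
  performs this reversal.\<close>

lemma apply_endo_unfold_block:
  "apply_endo \<sigma> (unfold_block t p)
    = (if t = F1 then unfold_block t (subst t a (mirror t p)) else inv_word (unfold_block t (subst t a (mirror t p))))"
proof (cases "t = F1")
  case True
  have "apply_endo \<sigma> (unfold_block t p) = reduce (concat (map (\<lambda>j. unfold_block t (subst_letter t a j)) p))"
    unfolding apply_endo_def concat_map_unfold_block
    by (rule reduce_concat_cong) (simp only: reduce_image_block if_P[OF True] reduce_unfold_block)
  then show ?thesis
    unfolding unfold_block_subst[symmetric] reduce_unfold_block using True by (simp add: mirror_def)
next
  case False
  have "apply_endo \<sigma> (unfold_block t p)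
      = reduce (concat (map (\<lambda>j. inv_word (unfold_block t (subst_letter t a j))) p))"
    unfolding apply_endo_def concat_map_unfold_block
    by (rule reduce_concat_cong)
      (simp only: reduce_image_block if_not_P[OF False] reduce_unfold_block reduce_inv_word)
  then show ?thesis
    using False
    by (simp add: concat_map_inv_word unfold_block_subst[symmetric] reduce_unfold_block reduce_inv_word
        mirror_def)
qed

lemma funpow_apply_endo_2:
  "(apply_endo \<sigma> ^^ n) [Gen 2] = (if pos t n then W t a n else inv_word (W t a n))"
proof (induction n)
  case 0
  then show ?case by (simp add: pos_def W_def block_def)
next
  case (Suc n)
  have "apply_endo \<sigma> (W t a n) = (if t = F1 then W t a (Suc n) else inv_word (W t a (Suc n)))"
    unfolding W_def by (simp add: apply_endo_unfold_block)
  with Suc show ?case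
    by (auto simp: pos_def apply_endo_inv_word)
qed

lemma funpow_apply_endo_1: "(apply_endo \<sigma> ^^ Suc n) [Gen 1] = (apply_endo \<sigma> ^^ n) [Gen 2]"
proof -
  have "\<sigma> 1 = [Gen 2]" by (cases t) simp_all
  then have "apply_endo \<sigma> [Gen 1] = [Gen 2]" by (simp add: apply_endo_def reduce_def)
  then show ?thesis by (simp add: funpow_Suc_right del: funpow.simps)
qed

text \<open>The class of \<sigma>^n(2) is A^n e_2, which \<pi> scales by \<mu>^n; passing to the
  inverse word leaves the norm unchanged.\<close>

lemma norm_pi_abel_W: "norm (\<pi> (abel (W t a n))) = \<bar>\<mu>\<bar> ^ n * norm (\<pi> (axis 2 1))"
proof -
  have "abel ((apply_endo \<sigma> ^^ n) [Gen 2]) = (A ^^ n) (axis 2 1)"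
    by (induction n) (simp_all add: abel_apply_endo)
  then have "(if pos t n then abel (W t a n) else - abel (W t a n)) = (A ^^ n) (axis 2 1)"
    by (simp add: funpow_apply_endo_2 split: if_splits)
  then have "norm (\<pi> (abel (W t a n))) = norm (\<pi> ((A ^^ n) (axis 2 1)))"
    by (metis norm_minus_cancel pi_minus)
  then show ?thesis
    by (simp add: pi_funpow_A power_abs)
qed


section \<open>Letters, growth and nesting of the generating words\<close>

lemma subst_letter_2: "2 \<in> set (subst_letter t a j)" "1 \<in> set (subst_letter t a 2)"
    "2 \<le> length (subst_letter t a 2)" "subst_letter t a j \<noteq> []"
proof -
  have adm: "admissible t a" by (rule admissible)
  show "2 \<in> set (subst_letter t a j)"
    using adm exhaust_2[of j] by (cases t) (auto simp: subst_letter_def)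
  show "1 \<in> set (subst_letter t a 2)" by (cases t) (simp_all add: subst_letter_def)
  show "2 \<le> length (subst_letter t a 2)"
    using adm by (cases t) (simp_all add: subst_letter_def)
  show "subst_letter t a j \<noteq> []" by (cases t) (simp_all add: subst_letter_def)
qed

lemma two_in_seed: "2 \<in> set (seed t a n)"
proof (induction n)
  case (Suc n)
  then have "2 \<in> set (mirror t (seed t a n))" by simp
  then obtain us vs where "mirror t (seed t a n) = us @ 2 # vs" by (meson split_list)
  then show ?case using subst_letter_2(1) by simp
qed simp

lemma one_in_seed: "1 \<in> set (seed t a (Suc n))"
proof -
  have "2 \<in> set (mirror t (seed t a n))" using two_in_seed[of n] by simp
  then obtain us vs where "mirror t (seed t a n) = us @ 2 # vs" by (meson split_list)
  then show ?thesis using subst_letter_2(2) by simp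
qed

lemma signed_letter_in_W: "signed_letter t j \<in> set (W t a (Suc n))"
proof -
  have "j \<in> set (seed t a (Suc n))"
    using exhaust_2[of j] one_in_seed[of n] two_in_seed[of "Suc n"] by metis
  then obtain us vs where "seed t a (Suc n) = us @ j # vs" by (meson split_list)
  then have "W t a (Suc n) = unfold_block t us @ block t j @ unfold_block t vs"
    unfolding W_def by simp
  then show ?thesis using signed_letter_in_block[of t j] by simp
qed

lemma length_W: "n < length (W t a n)"
proof -
  have "n < length (seed t a n)"
  proof (induction n)
    case (Suc n)
    have "length (mirror t (seed t a n)) < length (subst t a (mirror t (seed t a n)))"
      unfolding subst_def
      by (rule length_concat_map_gt[of _ 2]) (use two_in_seed[of n] subst_letter_2 in auto)
    with Suc show ?case by simp
  qed simp
  also have "length (seed t a n) \<le> length (W t a n)"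
    unfolding W_def unfold_block_def
  proof (rule length_concat_map_ge)
    show "block t j \<noteq> []" for j using signed_letter_in_block[of t j] by auto
  qed
  finally show ?thesis .
qed

text \<open>For \<open>F2\<close> and \<open>F4\<close> the reversal in each step exchanges prefixes
  and suffixes, so the relation alternates with parity; for \<open>F1\<close> prefixes
  persist.\<close>

lemma prefix_suffix_seed:
  "pos t n \<Longrightarrow> prefix (seed t a n) (seed t a (Suc n))" "\<not> pos t n \<Longrightarrow> suffix (seed t a n) (seed t a (Suc n))"
proof (induction n)
  case 0
  {
    case 1
    have "prefix [2] (subst_letter t a 2)"
      using admissible by (cases t) (auto simp: subst_letter_def prefix_replicate prefix_prefix)
    then show ?case by simp
  next
    case 2
    then show ?case by (simp add: pos_def)
  }
next
  case (Suc n)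
  {
    case 1
    show ?case
    proof (cases "t = F1")
      case True
      then show ?thesis
        using Suc.IH(1) by (simp add: pos_def mirror_def subst_def prefix_concat_map)
    next
      case False
      then have "suffix (seed t a n) (seed t a (Suc n))"
        using 1 Suc.IH(2) by (simp add: pos_def)
      with False show ?thesis
        unfolding seed.simps(2)[of t a n] seed.simps(2)[of t a "Suc n"] by (rule prefix_subst_mirror)
    qed
  next
    case 2
    then have "t \<noteq> F1" "prefix (seed t a n) (seed t a (Suc n))"
      using Suc.IH(1) by (auto simp: pos_def)
    then show ?case
      unfolding seed.simps(2)[of t a n] seed.simps(2)[of t a "Suc n"] by (rule suffix_subst_mirror)
  }
qed

text \<open>The defining limit for \<open>F2\<close> and \<open>F4\<close> runs over even exponents,
  and two reversals preserve prefixes.\<close>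

lemma prefix_seed_add_2: "even n \<Longrightarrow> prefix (seed t a n) (seed t a (Suc (Suc n)))"
proof (cases "t = F1")
  case True
  then show ?thesis
    using prefix_suffix_seed(1)[of n] prefix_suffix_seed(1)[of "Suc n"]
    by (auto simp: pos_def intro: prefix_order.trans simp del: seed.simps)
next
  case False
  assume "even n"
  then show ?thesis
  proof (induction n rule: less_induct)
    case (less n)
    show ?case
    proof (cases "n = 0")
      case True
      \<comment> \<open>The image of 2 ends in 1, so its mirror starts with 1 and the seed at index
        2 starts with the image of 1, which starts with 2.\<close>
      have "prefix [2] (subst_letter t a 1)"
        using admissible False by (cases t) (auto simp: subst_letter_def prefix_replicate prefix_prefix)
      moreover obtain us where "subst_letter t a 2 = us @ [1]"
        using False by (cases t) (auto simp: subst_letter_def)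
      ultimately show ?thesis
        using True False by (simp add: mirror_def prefix_prefix)
    next
      case nz: False
      obtain k where "n = 2 * k" using less.prems by (elim evenE)
      then obtain m where m: "n = Suc (Suc m)" "even m"
        using nz by (cases k) auto
      then have "prefix (seed t a m) (seed t a n)" using less.IH[of m] by simp
      then show ?thesis
        using False unfolding m(1) seed.simps
        by (intro prefix_subst_mirror suffix_subst_mirror) simp_all
    qed
  qed
qed

lemma prefix_W: "pos t n \<Longrightarrow> prefix (W t a n) (W t a (Suc n))"
  and suffix_W: "\<not> pos t n \<Longrightarrow> suffix (W t a n) (W t a (Suc n))"
  and prefix_W_add_2: "even n \<Longrightarrow> prefix (W t a n) (W t a (Suc (Suc n)))"
  unfolding W_def unfold_block_def
  by (intro prefix_concat_map suffix_concat_map prefix_suffix_seed prefix_seed_add_2; assumption)+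

section \<open>Occurrences of the generating words in the one-sided sequence\<close>

abbreviation \<omega> :: "nat \<Rightarrow> letter" where "\<omega> \<equiv> omega t a"

text \<open>The indices of positive sign are exactly those in the defining limit, and along them the
  words form a chain of prefixes.\<close>

lemma omega_eq: "pos t n \<Longrightarrow> k < length (W t a n) \<Longrightarrow> W t a n ! k = \<omega> k"
proof -
  let ?e = "\<lambda>n. if t = F1 then n else 2 * n"
  let ?V = "\<lambda>n. W t a (?e n)"
  have chain: "prefix (?V n) (?V (Suc n))" for n
    using prefix_W[of n] prefix_W_add_2[of "2 * n"] by (cases "t = F1") (simp_all add: pos_def)
  have len: "n < length (?V n)" for n
    using length_W[of "?e n"] by (auto split: if_splits)
  have "\<omega> = word_limit ?V"
    unfolding omega_def using funpow_apply_endo_2 by (intro arg_cong[of _ _ word_limit]) (auto simp: pos_def)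
  then have omega: "\<omega> = (\<lambda>k. ?V k ! k)"
    using word_limit_chain[of ?V, OF chain len] by simp
  assume "pos t n" and k: "k < length (W t a n)"
  then have "\<exists>m. n = ?e m" by (cases "t = F1") (auto simp: pos_def elim: evenE)
  then obtain m where "n = ?e m" ..
  then show ?thesis
    using chain_nth[of ?V, OF chain len, of k m] k unfolding omega by simp
qed

lemma word_prefix_eq_take:
  assumes "pos t n" "k \<le> length (W t a n)"
  shows "word_prefix \<omega> k = take k (W t a n)"
  using assms omega_eq[of n] by (intro nth_equalityI) (simp_all add: word_prefix_def)

lemma word_prefix_Suc: "word_prefix s (Suc k) = word_prefix s k @ [s k]"
  by (simp add: word_prefix_def)

lemma word_prefix_add: "word_prefix s (m + k) = word_prefix s m @ word_prefix (\<lambda>i. s (m + i)) k"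
  by (induction k) (simp_all add: word_prefix_def)

text \<open>At an index of negative sign the previous index has positive sign, and its word is a
  prefix both of \<omega> and of \<open>W t a n\<close>.\<close>

lemma prefix_omega_W:
  assumes "k < n"
  shows "prefix (word_prefix \<omega> k) (W t a n)"
proof (cases "pos t n")
  case True
  then show ?thesis
    using word_prefix_eq_take[OF True, of k] length_W[of n] assms by (simp add: take_is_prefix)
next
  case False
  then obtain m where m: "n = Suc m" "pos t m" using assms by (cases n) (auto simp: pos_def)
  then have "word_prefix \<omega> k = take k (W t a m)"
    using word_prefix_eq_take[of m k] length_W[of m] assms by simp
  then show ?thesis
    using prefix_W[OF m(2)] m(1) take_is_prefix prefix_order.trans by metis
qed

lemma W_occurs:
  obtains m where "\<And>k. k < length (W t a n) \<Longrightarrow> W t a n ! k = \<omega> (m + k)"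
    "norm (\<pi> (abel (word_prefix \<omega> m))) \<le> 2 * (\<bar>\<mu>\<bar> ^ n * norm (\<pi> (axis 2 1)))"
proof (cases "pos t n")
  case True
  show thesis
    by (rule that[of 0]) (simp_all add: True omega_eq word_prefix_def)
next
  case False
  \<comment> \<open>At a negative index the word is a suffix of its successor, which is a prefix of
    \<omega>. The class of the offset \<open>u\<close> is thus a difference of two classes with
    small projection.\<close>
  then obtain u where u: "W t a (Suc n) = u @ W t a n" using suffix_W suffix_def by blast
  have p: "pos t (Suc n)" using False by (simp add: pos_def)
  show thesis
  proof (rule that[of "length u"])
    fix k assume "k < length (W t a n)"
    then show "W t a n ! k = \<omega> (length u + k)"
      using omega_eq[OF p, of "length u + k"] by (simp add: u nth_append)
  next
    have "word_prefix \<omega> (length u) = u"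
      using word_prefix_eq_take[OF p, of "length u"] by (simp add: u)
    moreover have "abel u = abel (W t a (Suc n)) - abel (W t a n)"
      by (simp add: u)
    ultimately have "norm (\<pi> (abel (word_prefix \<omega> (length u))))
        \<le> norm (\<pi> (abel (W t a (Suc n)))) + norm (\<pi> (abel (W t a n)))"
      by (simp only: pi_diff norm_triangle_ineq4)
    also have "\<dots> = (\<bar>\<mu>\<bar> ^ Suc n + \<bar>\<mu>\<bar> ^ n) * norm (\<pi> (axis 2 1))"
      by (simp add: norm_pi_abel_W algebra_simps)
    also have "\<dots> \<le> (\<bar>\<mu>\<bar> ^ n + \<bar>\<mu>\<bar> ^ n) * norm (\<pi> (axis 2 1))"
      using abs_mu by (intro mult_right_mono add_right_mono power_decreasing) simp_all
    finally show "norm (\<pi> (abel (word_prefix \<omega> (length u)))) \<le> 2 * (\<bar>\<mu>\<bar> ^ n * norm (\<pi> (axis 2 1)))"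
      by simp
  qed
qed

section \<open>Boundedness of the prefix points\<close>

lemma abel_unfold_block_rev: "abel (unfold_block t (rev p)) = abel (unfold_block t p)"
  by (induction p) (simp_all add: add.commute)

lemma norm_pi_abel_subst:
  "norm (\<pi> (abel (unfold_block t (subst t a p)))) = \<bar>\<mu>\<bar> * norm (\<pi> (abel (unfold_block t p)))"
proof -
  have "abel (apply_endo \<sigma> (unfold_block t (mirror t p))) = A (abel (unfold_block t p))"
    unfolding abel_apply_endo by (simp add: mirror_def abel_unfold_block_rev)
  then have "A (abel (unfold_block t p))
      = (if t = F1 then abel (unfold_block t (subst t a p)) else - abel (unfold_block t (subst t a p)))"
    unfolding apply_endo_unfold_block by (cases "t = F1") simp_all
  then have "norm (\<pi> (abel (unfold_block t (subst t a p)))) = norm (\<pi> (A (abel (unfold_block t p))))"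
    by (metis norm_minus_cancel pi_minus)
  then show ?thesis by (simp add: pi_A)
qed

lemma seed_prefixes_bounded:
  obtains C where "\<And>n q. prefix q (seed t a n) \<Longrightarrow> norm (\<pi> (abel (unfold_block t q))) \<le> C"
proof -
  let ?N = "\<lambda>q. norm (\<pi> (abel (unfold_block t q)))"
  obtain B where B: "\<And>j q. prefix q (subst_letter t a j) \<Longrightarrow> ?N q \<le> B"
    by (rule prefixes_bounded[of "subst_letter t a" ?N]) blast
  have B0: "0 \<le> B" using B[of "[]"] by simp
  define E where "E = norm (\<pi> (axis 2 1))"
  \<comment> \<open>\<open>C\<close> solves C = |\<mu>| C + E + B, the recursion of the induction
    step.\<close>
  define C where "C = (E + B) / (1 - \<bar>\<mu>\<bar>)"
  have E0: "0 \<le> E" by (simp add: E_def)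
  have C: "C * \<bar>\<mu>\<bar> + E + B = C"
    using abs_mu by (simp add: C_def field_simps)
  have EC: "E \<le> C"
    using abs_mu E0 B0 by (simp add: C_def pos_le_divide_eq algebra_simps mult_le_one)
  have NW: "?N (seed t a n) \<le> E" for n
    using norm_pi_abel_W[of n] abs_mu by (simp add: W_def E_def mult_left_le_one_le power_le_one)
  have "?N q \<le> C" if "prefix q (seed t a n)" for n q
    using that
  proof (induction n arbitrary: q)
    case 0
    then have "q = [] \<or> q = seed t a 0" by (auto simp: prefix_Cons)
    then show ?case using NW[of 0] EC E0 by auto
  next
    case (Suc n)
    then have "prefix q (concat (map (subst_letter t a) (mirror t (seed t a n))))" by (simp add: subst_def)
    then obtain p j r where p: "prefix p (mirror t (seed t a n))" and r: "prefix r (subst_letter t a j)"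
      and q: "q = subst t a p @ r"
      unfolding subst_def by (rule prefix_concat_mapE)
    \<comment> \<open>For \<open>F2\<close> and \<open>F4\<close> the piece \<open>p\<close> is a
      reversed suffix of the seed, and a suffix is the whole word, of norm at most \<open>E\<close>,
      minus a prefix \<open>u\<close>.\<close>
    have "?N p \<le> E + C"
    proof (cases "t = F1")
      case True
      then show ?thesis using Suc.IH[of p] p E0 by (simp add: mirror_def)
    next
      case False
      then have "suffix (rev p) (seed t a n)" using p by (simp add: mirror_def suffix_to_prefix)
      then obtain u where u: "seed t a n = u @ rev p" by (auto simp: suffix_def)
      have "abel (unfold_block t p) = abel (unfold_block t (seed t a n)) - abel (unfold_block t u)"
        unfolding u by (simp add: abel_unfold_block_rev)
      then have "?N p \<le> ?N (seed t a n) + ?N u"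
        by (simp only: pi_diff norm_triangle_ineq4)
      then show ?thesis using NW[of n] Suc.IH[of u] u by simp
    qed
    then have "\<bar>\<mu>\<bar> * ?N p \<le> \<bar>\<mu>\<bar> * (E + C)" by (intro mult_left_mono) simp_all
    moreover have "\<bar>\<mu>\<bar> * E \<le> E" using abs_mu E0 by (simp add: mult_left_le_one_le)
    moreover have "?N q \<le> \<bar>\<mu>\<bar> * ?N p + ?N r"
      unfolding q by (simp add: pi_add norm_pi_abel_subst[symmetric] norm_triangle_ineq)
    ultimately show ?case using B[OF r] C by (simp add: algebra_simps)
  qed
  then show thesis using that by blast
qed

lemma prefix_point_eq: "prefix_point t a k = - \<pi> (abel (word_prefix \<omega> k))"
  by (simp add: prefix_point_def \<pi>_def)

text \<open>A prefix of \<omega> is an unfolded prefix of a seed followed by part of one block, and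
  both contributions are bounded.\<close>

lemma bounded_prefix_point: "bounded (range (prefix_point t a))"
proof -
  obtain C where C: "\<And>n q. prefix q (seed t a n) \<Longrightarrow> norm (\<pi> (abel (unfold_block t q))) \<le> C"
    by (rule seed_prefixes_bounded) blast
  obtain B where B: "\<And>j q. prefix q (block t j) \<Longrightarrow> norm (\<pi> (abel q)) \<le> B"
    by (rule prefixes_bounded[of "block t" "\<lambda>q. norm (\<pi> (abel q))"]) blast
  have "norm (prefix_point t a k) \<le> C + B" for k
  proof -
    have "prefix (word_prefix \<omega> k) (concat (map (block t) (seed t a (Suc k))))"
      using prefix_omega_W[of k "Suc k"] by (simp add: W_def unfold_block_def del: seed.simps)
    then obtain p j r where p: "prefix p (seed t a (Suc k))" and r: "prefix r (block t j)"
        and eq: "word_prefix \<omega> k = unfold_block t p @ r"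
      unfolding unfold_block_def by (rule prefix_concat_mapE)
    have "norm (prefix_point t a k) = norm (\<pi> (abel (unfold_block t p)) + \<pi> (abel r))"
      by (simp only: prefix_point_eq eq abel_append pi_add norm_minus_cancel)
    also have "\<dots> \<le> C + B"
      using C[OF p] B[OF r] by (rule norm_triangle_mono)
    finally show ?thesis .
  qed
  then show ?thesis by (auto simp: bounded_iff)
qed

end


section \<open>Rauzy fractals as closures of prefix points\<close>

context automorphism_family
begin

definition approximation :: "2 set \<Rightarrow> int ^ 2 \<Rightarrow> nat \<Rightarrow> (real ^ 2) set" where
  "approximation I v n
    = ((*v) M ^^ n) ` proj \<sigma> ` realize ((tile_subst \<sigma> ^^ n) (tile_family t I v))"

lemma mem_approximation:
  assumes "(apply_endo \<sigma> ^^ n) [Gen l] = (if pos t m then W t a m else inv_word (W t a m))"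
  shows "(z, l) \<in> Poly_Mapping.keys ((tile_subst \<sigma> ^^ n) (tile_family t I v)) \<longleftrightarrow>
    (\<exists>k < length (W t a m). W t a m ! k \<in> signed_letter t ` I \<and>
      (A ^^ n) z = v + (if pos t m then abel (W t a m) else 0) - abel (take k (W t a m)))"
  by (rule keys_tile_subst_funpow_tile_family[OF matrix_inv_sigma signed_word_W assms])

text \<open>The image of the letter 1 lags one step behind that of 2, so the index is n or n+1;
  hence step n+1 is compared with \<mu>^n below.\<close>

lemma funpow_apply_endo_Suc:
  obtains m where "n \<le> m"
    "(apply_endo \<sigma> ^^ Suc n) [Gen l] = (if pos t m then W t a m else inv_word (W t a m))"
proof (cases "l = 2")
  case True
  then show thesis
    using that[of "Suc n"] funpow_apply_endo_2[of "Suc n"] by (simp del: funpow.simps)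
next
  case False
  then have "l = 1" using exhaust_2[of l] by simp
  then show thesis
    using that[of n] funpow_apply_endo_1[of n] funpow_apply_endo_2[of n] by (simp del: funpow.simps)
qed

text \<open>Three errors add up: the class of \<open>W t a m\<close> present for positive sign
  (\<open>E\<close>), the offset of \<open>W t a m\<close> in \<omega> (\<open>2 * E\<close>), and
  the projected segment (\<open>E'\<close>).\<close>

lemma approximation_near_prefix_points:
  obtains C where "\<And>n x. x \<in> approximation I v (Suc n) \<Longrightarrow>
    \<exists>k. \<omega> k \<in> signed_letter t ` I \<and> dist x (\<pi> v + prefix_point t a k) \<le> C * \<bar>\<mu>\<bar> ^ n"
proof -
  define E where "E = norm (\<pi> (axis 2 1))"
  define E' where "E' = norm (proj \<sigma> (axis 1 1)) + norm (proj \<sigma> (axis 2 1))"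
  have E0: "0 \<le> E" "0 \<le> E'" by (simp_all add: E_def E'_def)
  have "\<exists>k. \<omega> k \<in> signed_letter t ` I \<and> dist x (\<pi> v + prefix_point t a k) \<le> (3 * E + E') * \<bar>\<mu>\<bar> ^ n"
    if x: "x \<in> approximation I v (Suc n)" for n x
  proof -
    obtain z l s where z: "(z, l) \<in> Poly_Mapping.keys ((tile_subst \<sigma> ^^ Suc n) (tile_family t I v))"
      and s: "0 \<le> s" "s \<le> 1"
      and x_eq: "x = \<pi> ((A ^^ Suc n) z) + (s * \<mu> ^ Suc n) *\<^sub>R proj \<sigma> (axis (if l = 1 then 2 else 1) 1)"
      using x unfolding approximation_def mem_approximation_iff by blast
    obtain m where m: "n \<le> m"
        "(apply_endo \<sigma> ^^ Suc n) [Gen l] = (if pos t m then W t a m else inv_word (W t a m))"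
      by (rule funpow_apply_endo_Suc)
    let ?w = "W t a m"
    define c where "c = (if pos t m then abel ?w else 0)"
    obtain k where k: "k < length ?w" "?w ! k \<in> signed_letter t ` I"
        and Az: "(A ^^ Suc n) z = v + c - abel (take k ?w)"
      using z unfolding mem_approximation[OF m(2)] c_def by blast
    obtain r where r: "\<And>i. i < length ?w \<Longrightarrow> ?w ! i = \<omega> (r + i)"
        "norm (\<pi> (abel (word_prefix \<omega> r))) \<le> 2 * (\<bar>\<mu>\<bar> ^ m * norm (\<pi> (axis 2 1)))"
      by (rule W_occurs) blast
    let ?P = "proj \<sigma> (axis (if l = 1 then 2 else 1) 1)"
    have "word_prefix (\<lambda>i. \<omega> (r + i)) k = take k ?w"
      using k(1) r(1) by (intro nth_equalityI) (simp_all add: word_prefix_def)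
    then have "abel (word_prefix \<omega> (r + k)) = abel (word_prefix \<omega> r) + abel (take k ?w)"
      by (simp add: word_prefix_add)
    then have diff: "x - (\<pi> v + prefix_point t a (r + k))
        = \<pi> c + \<pi> (abel (word_prefix \<omega> r)) + (s * \<mu> ^ Suc n) *\<^sub>R ?P"
      unfolding x_eq Az prefix_point_eq by (simp add: pi_add pi_diff del: power_Suc)
    have mn: "\<bar>\<mu>\<bar> ^ m * E \<le> \<bar>\<mu>\<bar> ^ n * E"
      using abs_mu m(1) E0 by (intro mult_right_mono power_decreasing) simp_all
    have "norm (\<pi> c) \<le> \<bar>\<mu>\<bar> ^ n * E"
      using mn E0 norm_pi_abel_W[of m] by (auto simp: c_def E_def)
    moreover have "norm (\<pi> (abel (word_prefix \<omega> r))) \<le> 2 * (\<bar>\<mu>\<bar> ^ n * E)"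
      using r(2) mn by (simp add: E_def)
    moreover have "norm ((s * \<mu> ^ Suc n) *\<^sub>R ?P) \<le> \<bar>\<mu>\<bar> ^ n * E'"
    proof -
      have "\<bar>s * \<mu> ^ Suc n\<bar> = (s * \<bar>\<mu>\<bar>) * \<bar>\<mu>\<bar> ^ n"
        using s by (simp add: abs_mult power_abs)
      also have "\<dots> \<le> 1 * \<bar>\<mu>\<bar> ^ n"
        using s abs_mu by (intro mult_right_mono mult_le_one) simp_all
      finally have "\<bar>s * \<mu> ^ Suc n\<bar> \<le> \<bar>\<mu>\<bar> ^ n" by simp
      moreover have "norm ?P \<le> E'" by (simp add: E'_def)
      ultimately show ?thesis unfolding norm_scaleR by (intro mult_mono) simp_all
    qed
    ultimately have "dist x (\<pi> v + prefix_point t a (r + k)) \<le> (3 * E + E') * \<bar>\<mu>\<bar> ^ n"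
      unfolding dist_norm diff
      using norm_triangle_ineq[of "\<pi> c + \<pi> (abel (word_prefix \<omega> r))" "(s * \<mu> ^ Suc n) *\<^sub>R ?P"]
        norm_triangle_ineq[of "\<pi> c" "\<pi> (abel (word_prefix \<omega> r))"]
      by (simp add: algebra_simps del: power_Suc)
    moreover have "\<omega> (r + k) \<in> signed_letter t ` I"
      using k r(1) by metis
    ultimately show ?thesis by blast
  qed
  then show thesis using that by blast
qed

text \<open>Tiles of type 2 suffice, since \<omega> and \<open>W t a n\<close> share the prefix of
  length k+1; only the class of \<open>W t a n\<close> remains as an error.\<close>

lemma prefix_point_near_approximation:
  assumes "Suc k < n" "\<omega> k \<in> signed_letter t ` I"
  obtains x where "x \<in> approximation I v n"
    "dist x (\<pi> v + prefix_point t a k) \<le> norm (\<pi> (axis 2 1)) * \<bar>\<mu>\<bar> ^ n"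
proof -
  let ?w = "W t a n"
  define c where "c = (if pos t n then abel ?w else 0)"
  have pre: "prefix (word_prefix \<omega> (Suc k)) ?w"
    using assms(1) by (rule prefix_omega_W)
  then have len: "k < length ?w" using prefix_length_le[OF pre] by (simp add: word_prefix_def)
  have "?w ! i = \<omega> i" if "i \<le> k" for i
    using nth_prefix[OF pre, of i] that by (simp add: word_prefix_def del: upt_Suc)
  then have wk: "?w ! k = \<omega> k" and take: "take k ?w = word_prefix \<omega> k"
    using len by (auto intro!: nth_equalityI simp: word_prefix_def)
  define z where "z = ((*v) (matrix_inv (endo_matrix \<sigma>)) ^^ n) (v + c - abel (take k ?w))"
  have Az: "(A ^^ n) z = v + c - abel (take k ?w)"
    unfolding z_def by (rule funpow_left_inverse) (rule matrix_inv_sigma)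
  then have "(z, 2) \<in> Poly_Mapping.keys ((tile_subst \<sigma> ^^ n) (tile_family t I v))"
    unfolding mem_approximation[OF funpow_apply_endo_2] using len wk assms(2) by (auto simp: c_def)
  \<comment> \<open>The end point s = 0 of the tile is taken, which adds no segment error.\<close>
  then have "\<pi> ((A ^^ n) z) \<in> approximation I v n"
    unfolding approximation_def mem_approximation_iff
    by (intro exI[of _ z] exI[of _ 2] exI[of _ 0]) simp
  moreover have "\<pi> ((A ^^ n) z) - (\<pi> v + prefix_point t a k) = \<pi> c"
    by (simp add: Az prefix_point_eq take pi_add pi_diff)
  moreover have "norm (\<pi> c) \<le> norm (\<pi> (axis 2 1)) * \<bar>\<mu>\<bar> ^ n"
    using norm_pi_abel_W[of n] by (simp add: c_def mult.commute)
  ultimately show thesis using that by (metis dist_norm)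
qed

lemma eventually_mu_power_less:
  fixes C e :: real
  assumes "e > 0"
  shows "\<forall>\<^sub>F n in sequentially. C * \<bar>\<mu>\<bar> ^ n < e"
proof -
  have "(\<lambda>n. C * \<bar>\<mu>\<bar> ^ n) \<longlonglongrightarrow> C * 0"
    by (intro tendsto_mult_left mu_power_tendsto)
  then show ?thesis using assms by (auto dest: order_tendstoD)
qed

text \<open>Both approximation errors are geometric in |\<mu>| and the prefix points are bounded, so
  the Hausdorff criterion applies.\<close>

lemma rauzy_tile_family:
  assumes "I \<noteq> {}"
  shows "rauzy \<sigma> (tile_family t I v)
    = closure {\<pi> v + prefix_point t a k | k. \<omega> k \<in> signed_letter t ` I}"
proof -
  let ?Y = "{\<pi> v + prefix_point t a k | k. \<omega> k \<in> signed_letter t ` I}"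
  have "hausdorff_lim (approximation I v) = closure ?Y"
  proof (rule hausdorff_lim_eq_closure)
    have "bounded ((+) (\<pi> v) ` range (prefix_point t a))"
      using bounded_prefix_point by (rule bounded_translation)
    then show "bounded ?Y" by (rule bounded_subset) auto
  next
    obtain i where "i \<in> I" using assms by auto
    \<comment> \<open>Index 2 has positive sign in every family, and its word already contains both
      signed letters.\<close>
    obtain n where n: "pos t (Suc n)" using that[of 1] by (auto simp: pos_def)
    then obtain k where "k < length (W t a (Suc n))" "W t a (Suc n) ! k = signed_letter t i"
      using signed_letter_in_W[of i n] by (auto simp: in_set_conv_nth)
    then have "\<omega> k \<in> signed_letter t ` I"
      using omega_eq[OF n] \<open>i \<in> I\<close> by auto
    then show "?Y \<noteq> {}" by blast
  next
    fix e :: real assume e: "e > 0"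
    obtain C where C: "\<And>n x. x \<in> approximation I v (Suc n) \<Longrightarrow>
        \<exists>k. \<omega> k \<in> signed_letter t ` I \<and> dist x (\<pi> v + prefix_point t a k) \<le> C * \<bar>\<mu>\<bar> ^ n"
      by (rule approximation_near_prefix_points) blast
    have "\<forall>\<^sub>F n in sequentially. \<forall>x\<in>approximation I v (Suc n). \<exists>y\<in>?Y. dist x y < e"
      using eventually_mu_power_less[OF e, of C]
    proof eventually_elim
      case (elim n)
      show ?case
      proof
        fix x assume "x \<in> approximation I v (Suc n)"
        from C[OF this] obtain k where "\<omega> k \<in> signed_letter t ` I"
          "dist x (\<pi> v + prefix_point t a k) \<le> C * \<bar>\<mu>\<bar> ^ n" by blast
        with elim show "\<exists>y\<in>?Y. dist x y < e" by force
      qed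
    qed
    then show "\<forall>\<^sub>F n in sequentially. \<forall>x\<in>approximation I v n. \<exists>y\<in>?Y. dist x y < e"
      by (rule eventually_sequentially_Suc[THEN iffD1])
  next
    fix y and e :: real assume "y \<in> ?Y" and e: "e > 0"
    then obtain k where k: "\<omega> k \<in> signed_letter t ` I" and y: "y = \<pi> v + prefix_point t a k" by blast
    show "\<forall>\<^sub>F n in sequentially. \<exists>x\<in>approximation I v n. dist x y < e"
      using eventually_mu_power_less[OF e, of "norm (\<pi> (axis 2 1))"] eventually_gt_at_top[of "Suc k"]
    proof eventually_elim
      case (elim n)
      obtain x where "x \<in> approximation I v n" "dist x y \<le> norm (\<pi> (axis 2 1)) * \<bar>\<mu>\<bar> ^ n"
        unfolding y by (rule prefix_point_near_approximation[OF elim(2) k])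
      with elim(1) show ?case by force
    qed
  qed
  then show ?thesis by (simp add: rauzy_def approximation_def[abs_def])
qed

lemma X_part_eq: "X_part t a i = closure (Y_part t a i)"
proof -
  have "base_tile t i = tile_family t {i} 0"
    by (simp add: base_tile_def tile_family_def base_point_def)
  moreover have "{\<pi> 0 + prefix_point t a k | k. \<omega> k \<in> signed_letter t ` {i}} = Y_part t a i"
    by (simp add: Y_part_def)
  ultimately show ?thesis
    using rauzy_tile_family[of "{i}" 0] by (simp add: X_part_def)
qed

text \<open>Translation by minus the vector of the signed letter moves the base tile to the opposite
  choice and sends the point before an occurrence of that letter to the point after it.\<close>

lemma X_part'_eq: "X_part' t a i = closure (Y_part' t a i)"
proof -
  let ?v = "- abel_letter (signed_letter t i)"
  have "base_tile' t i = tile_family t {i} ?v"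
    using eps_cases[of t i]
    by (auto simp: base_tile'_def tile_family_def base_point_def signed_letter_def)
  moreover have "\<pi> ?v + prefix_point t a k = prefix_point t a (Suc k)" if "\<omega> k = signed_letter t i" for k
    using that by (simp add: prefix_point_eq word_prefix_Suc pi_add pi_minus)
  then have "{\<pi> ?v + prefix_point t a k | k. \<omega> k \<in> signed_letter t ` {i}} = Y_part' t a i"
    unfolding Y_part'_def by force
  ultimately show ?thesis
    using rauzy_tile_family[of "{i}" ?v] by (simp add: X_part'_def)
qed

text \<open>
  The tiles of the total fractal give the points of all prefixes, including the empty one, which is a
  limit of the points of the prefixes \<open>W t a (2 * n)\<close>.
\<close>

lemma X_total_eq: "X_total t a = closure (Y_total t a)"
proof -
  have "base_tile t 1 + base_tile t 2 = tile_family t UNIV 0"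
    by (simp add: base_tile_def tile_family_def base_point_def sum_2)
  moreover have "\<omega> k \<in> range (signed_letter t)" for k
  proof -
    have n: "pos t (2 * k)" "k < length (W t a (2 * k))"
      using length_W[of "2 * k"] by (auto simp: pos_def)
    then have "\<omega> k \<in> set (W t a (2 * k))" using omega_eq[OF n] by (metis nth_mem)
    then show ?thesis using signed_word_W[of t a "2 * k"] by (auto simp: signed_word_def)
  qed
  then have "{\<pi> 0 + prefix_point t a k | k. \<omega> k \<in> range (signed_letter t)} = range (prefix_point t a)"
    by auto
  ultimately have X: "X_total t a = closure (range (prefix_point t a))"
    using rauzy_tile_family[of UNIV 0] by (simp add: X_total_def)
  have "prefix_point t a 0 \<in> closure (Y_total t a)"
    unfolding closure_approachable
  proof (intro allI impI)
    fix e :: real assume "e > 0"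
    from eventually_mu_power_less[OF this, of "norm (\<pi> (axis 2 1))"]
    obtain N where N: "\<And>n. n \<ge> N \<Longrightarrow> norm (\<pi> (axis 2 1)) * \<bar>\<mu>\<bar> ^ n < e"
      by (auto simp: eventually_sequentially)
    let ?w = "W t a (2 * N)"
    obtain k where k: "length ?w = Suc k"
      using length_W[of "2 * N"] by (cases "length ?w") auto
    have "word_prefix \<omega> (Suc k) = ?w"
      using word_prefix_eq_take[of "2 * N" "Suc k"] k by (simp add: pos_def)
    then have "dist (prefix_point t a (Suc k)) (prefix_point t a 0) = norm (\<pi> (abel ?w))"
      by (simp add: prefix_point_eq word_prefix_def[of _ 0])
    also have "\<dots> < e" using N[of "2 * N"] by (simp add: norm_pi_abel_W mult.commute)
    finally show "\<exists>y\<in>Y_total t a. dist y (prefix_point t a 0) < e"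
      unfolding Y_total_def by blast
  qed
  moreover have "range (prefix_point t a) = insert (prefix_point t a 0) (Y_total t a)"
  proof -
    have "prefix_point t a k \<in> insert (prefix_point t a 0) (Y_total t a)" for k
      by (cases k) (auto simp: Y_total_def)
    then show ?thesis by (auto simp: Y_total_def)
  qed
  ultimately show ?thesis
    unfolding X using closure_subset[of "Y_total t a"]
    by (intro equalityI closure_minimal closure_mono) auto
qed

end

theorem theorem6:
  fixes t :: family and a :: int
  assumes "admissible t a"
  shows "X_total t a = closure (Y_total t a)
    \<and> (\<forall>i. X_part t a i = closure (Y_part t a i))
    \<and> (\<forall>i. X_part' t a i = closure (Y_part' t a i))"
proof -
  interpret automorphism_family t a
    by standard (rule assms)
  show ?thesis by (simp add: X_total_eq X_part_eq X_part'_eq)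
qed

end
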